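(* Let $(\Omega,\Sigma,\mu)$ be a finite measure space, let $E$ be a faithful solid subalgebra of $L^0(\Omega)$, and let $\mathcal X$ be a measurable bundle of Banach algebras over $\Omega$ with a vector-valued lifting, such that $E(\Omega,\mathcal X)$ is unital. If every element of the algebra $E(\Omega,\mathcal X)$ with unit support is invertible, then $E(\Omega,\mathcal X)$ is isometrically isomorphic to $E$.
   Context: **Base algebra.** $L^0(\Omega)$ is the algebra of a.e.-equivalence classes of complex measurable functions on $\Omega$, $L^\infty(\Omega)$ the subalgebra of classes of essentially bounded functions, and $\mathcal L^\infty(\Omega)$ the algebra of bounded measurable functions on $\Omega$ (functions, not classes). $\mathbf 1$ is the constant function $1$. A faithful solid subalgebra $E\subset L^0(\Omega)$ is a subalgebra such that $x\in L^0(\Omega)$, $y\in E$, $|x|\le|y|$ imply $x\in E$, and $E^\perp=\{0\}$ (only $0$ is disjoint from all of $E$); it is assumed that $L^\infty(\Omega)\subset E\subset L^0(\Omega)$. **Measurable bundles.** Let $\mathcal X$ assign to each $\omega\in\Omega$ a Banach algebra $X(\omega)\ne\{0\}$. A section is a function $u$ defined almost everywhere on $\Omega$ (with domain $\mathrm{dom}\,u$) with $u(\omega)\in X(\omega)$. A pair $(\mathcal X,L)$, $L$ a set of sections, is a measurable bundle of Banach algebras if: (1) $\lambda_1c_1+\lambda_2c_2\in L$ for $\lambda_i\in\mathbb C$, $c_i\in L$ (pointwise on $\mathrm{dom}\,c_1\cap\mathrm{dom}\,c_2$); (2) $\omega\mapsto\|c(\omega)\|_{X(\omega)}$ is measurable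 for all $c\in L$; (3) for every $\omega\in\Omega$ the set $\{c(\omega):c\in L,\ \omega\in\mathrm{dom}\,c\}$ is dense in $X(\omega)$; (4) $uv\in L$ for $u,v\in L$ (pointwise product on the intersection of domains). A section is simple if it has the form $\sum_{i=1}^n\chi_{A_i}c_i$ with $c_i\in L$, $A_i\in\Sigma$; a section $u$ is measurable if there are simple sections $s_n$ with $\|s_n(\omega)-u(\omega)\|_{X(\omega)}\to0$ for almost all $\omega$. $M(\Omega,\mathcal X)$ is the set of measurable sections, $L^0(\Omega,\mathcal X)$ its quotient by a.e. equality, $\hat u$ the class of $u$, $\|\hat u\|\in L^0(\Omega)$ the class of $\omega\mapsto\|u(\omega)\|_{X(\omega)}$, with product $\hat u\hat v=\widehat{u(\omega)v(\omega)}$. Put $E(\Omega,\mathcal X)=\{x\in L^0(\Omega,\mathcal X):\|x\|\in E\}$ (an algebra and $E$-module with $E$-valued norm $\|\cdot\|$), $L^\infty(\Omega,\mathcal X)=\{x\in L^0(\Omega,\mathcal X):\|x\|\in L^\infty(\Omega)\}$, $\mathcal L^\infty(\Omega,\mathcal X)=\{u\in M(\Omega,\mathcal X):\|u(\cdot)\|_{X(\cdot)}\in\mathcal L^\infty(\Omega)\}$. "Unital" means that $E(\Omega,\mathcal X)$ has a unit $e$ with $\|e\|=\mathbf 1$. **Liftings.** A lifting $p:L^\infty(\Omega)\to\mathcal L^\infty(\Omega)$ is (in the usual sense) a unital, conjugation-preserving algebra homomorphism with $p(\hat f)\in\hat f$, $\mathrm{dom}\,p(\hat f)=\Omega$, and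 $\|p(\hat f)\|_{\mathcal L^\infty(\Omega)}=\|\hat f\|_{L^\infty(\Omega)}$; such a $p$ is fixed. A vector-valued lifting associated with $p$ is a map $\ell_{\mathcal X}:L^\infty(\Omega,\mathcal X)\to\mathcal L^\infty(\Omega,\mathcal X)$ such that for all $\hat u,\hat v\in L^\infty(\Omega,\mathcal X)$, $a\in L^\infty(\Omega)$: (1) $\ell_{\mathcal X}(\hat u)\in\hat u$ and $\mathrm{dom}\,\ell_{\mathcal X}(\hat u)=\Omega$; (2) $\|\ell_{\mathcal X}(\hat u)(\omega)\|_{X(\omega)}=p(\|\hat u\|)(\omega)$ for all $\omega$; (3) $\ell_{\mathcal X}(\hat u+\hat v)=\ell_{\mathcal X}(\hat u)+\ell_{\mathcal X}(\hat v)$; (4) $\ell_{\mathcal X}(a\hat u)=p(a)\ell_{\mathcal X}(\hat u)$; (5) $\ell_{\mathcal X}(\hat u\hat v)=\ell_{\mathcal X}(\hat u)\ell_{\mathcal X}(\hat v)$; (6) for every $\omega$ the set $\{\ell_{\mathcal X}(\hat u)(\omega):\hat u\in L^\infty(\Omega,\mathcal X)\}$ is dense in $X(\omega)$. **Support.** The support of $x\in E(\Omega,\mathcal X)$ is the indicator function of $\{\omega\in\Omega:\|x\|(\omega)\ne0\}$; $x$ has unit support if its support is $\mathbf 1$ (i.e. $\|x\|(\omega)\neq 0$ for almost all $\omega$). **Isometric isomorphism.** Here $E$ carries the $E$-valued norm $a\mapsto|a|$; "isometrically isomorphic" means there is a bijective $E$-linear multiplicative map preserving the $E$-valued norms. 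*)

theory Defs
  imports
    "HOL-Probability.Essential_Supremum"
    "HOL-Algebra.Algebraic_Closure_Type"
begin

text \<open>
  The fibres of a bundle vary from point to point, so they are records with an explicit carrier
  inside one common type. Banach algebras need not be unital: the field \<open>one\<close> inherited from
  the ring record is not used anywhere.
\<close>

record 'b normed_alg = "(complex, 'b) module" +
  nrm :: "'b \<Rightarrow> real"

locale banach_algebra =
  Module.module "ring_of_type_algebra :: complex ring" A for A :: "'b normed_alg" (structure) +
  assumes mult_closed: "\<lbrakk>x \<in> carrier A; y \<in> carrier A\<rbrakk> \<Longrightarrow> x \<otimes> y \<in> carrier A"
    and mult_assoc: "\<lbrakk>x \<in> carrier A; y \<in> carrier A; z \<in> carrier A\<rbrakk>
      \<Longrightarrow> (x \<otimes> y) \<otimes> z = x \<otimes> (y \<otimes> z)"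
    and distr_l: "\<lbrakk>x \<in> carrier A; y \<in> carrier A; z \<in> carrier A\<rbrakk>
      \<Longrightarrow> (x \<oplus> y) \<otimes> z = x \<otimes> z \<oplus> y \<otimes> z"
    and distr_r: "\<lbrakk>x \<in> carrier A; y \<in> carrier A; z \<in> carrier A\<rbrakk>
      \<Longrightarrow> z \<otimes> (x \<oplus> y) = z \<otimes> x \<oplus> z \<otimes> y"
    and smult_mult_l: "\<lbrakk>x \<in> carrier A; y \<in> carrier A\<rbrakk>
      \<Longrightarrow> (c \<odot> x) \<otimes> y = c \<odot> (x \<otimes> y)"
    and smult_mult_r: "\<lbrakk>x \<in> carrier A; y \<in> carrier A\<rbrakk>
      \<Longrightarrow> x \<otimes> (c \<odot> y) = c \<odot> (x \<otimes> y)"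
    and nrm_nonneg: "x \<in> carrier A \<Longrightarrow> 0 \<le> nrm A x"
    and nrm_eq_0_iff: "x \<in> carrier A \<Longrightarrow> nrm A x = 0 \<longleftrightarrow> x = \<zero>"
    and nrm_triangle: "\<lbrakk>x \<in> carrier A; y \<in> carrier A\<rbrakk> \<Longrightarrow> nrm A (x \<oplus> y) \<le> nrm A x + nrm A y"
    and nrm_smult: "x \<in> carrier A \<Longrightarrow> nrm A (c \<odot> x) = cmod c * nrm A x"
    and nrm_mult: "\<lbrakk>x \<in> carrier A; y \<in> carrier A\<rbrakk> \<Longrightarrow> nrm A (x \<otimes> y) \<le> nrm A x * nrm A y"
    and complete: "\<lbrakk>\<forall>n::nat. s n \<in> carrier A;
        \<forall>\<epsilon>>0. \<exists>N. \<forall>m\<ge>N. \<forall>n\<ge>N. nrm A (s m \<ominus> s n) < \<epsilon>\<rbrakk>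
      \<Longrightarrow> \<exists>x\<in>carrier A. (\<lambda>n. nrm A (s n \<ominus> x)) \<longlonglongrightarrow> 0"

definition dense_in :: "'b normed_alg \<Rightarrow> 'b set \<Rightarrow> bool" where
  "dense_in A S \<longleftrightarrow> S \<subseteq> carrier A \<and>
     (\<forall>x\<in>carrier A. \<forall>\<epsilon>>0. \<exists>y\<in>S. nrm A (x \<ominus>\<^bsub>A\<^esub> y) < \<epsilon>)"

text \<open>
  The measure need not be complete, so \<open>f\<close> itself may fail to be measurable below; the class
  then consists of the measurable functions equal to \<open>f\<close> almost everywhere. Values outside
  \<open>space M\<close> are irrelevant.
\<close>

definition fun_class :: "'a measure \<Rightarrow> ('a \<Rightarrow> complex) \<Rightarrow> ('a \<Rightarrow> complex) set" where
  "fun_class M f = {g \<in> borel_measurable M. AE \<omega> in M. g \<omega> = f \<omega>}"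

definition L0 :: "'a measure \<Rightarrow> ('a \<Rightarrow> complex) set set" where
  "L0 M = fun_class M ` borel_measurable M"

definition L0_one :: "'a measure \<Rightarrow> ('a \<Rightarrow> complex) set" where
  "L0_one M = fun_class M (\<lambda>_. 1)"

text \<open>
  Operations on classes are unions over representatives: all representatives give the same class.
\<close>

definition L0_add ::
  "'a measure \<Rightarrow> ('a \<Rightarrow> complex) set \<Rightarrow> ('a \<Rightarrow> complex) set \<Rightarrow> ('a \<Rightarrow> complex) set" where
  "L0_add M a b = (\<Union>f\<in>a. \<Union>g\<in>b. fun_class M (\<lambda>\<omega>. f \<omega> + g \<omega>))"

definition L0_mult ::
  "'a measure \<Rightarrow> ('a \<Rightarrow> complex) set \<Rightarrow> ('a \<Rightarrow> complex) set \<Rightarrow> ('a \<Rightarrow> complex) set" where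
  "L0_mult M a b = (\<Union>f\<in>a. \<Union>g\<in>b. fun_class M (\<lambda>\<omega>. f \<omega> * g \<omega>))"

definition L0_scale :: "'a measure \<Rightarrow> complex \<Rightarrow> ('a \<Rightarrow> complex) set \<Rightarrow> ('a \<Rightarrow> complex) set" where
  "L0_scale M c a = (\<Union>f\<in>a. fun_class M (\<lambda>\<omega>. c * f \<omega>))"

definition L0_cnj :: "'a measure \<Rightarrow> ('a \<Rightarrow> complex) set \<Rightarrow> ('a \<Rightarrow> complex) set" where
  "L0_cnj M a = (\<Union>f\<in>a. fun_class M (\<lambda>\<omega>. cnj (f \<omega>)))"

definition L0_abs :: "'a measure \<Rightarrow> ('a \<Rightarrow> complex) set \<Rightarrow> ('a \<Rightarrow> complex) set" where
  "L0_abs M a = (\<Union>f\<in>a. fun_class M (\<lambda>\<omega>. complex_of_real (cmod (f \<omega>))))"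

definition abs_le :: "'a measure \<Rightarrow> ('a \<Rightarrow> complex) set \<Rightarrow> ('a \<Rightarrow> complex) set \<Rightarrow> bool" where
  "abs_le M a b \<longleftrightarrow> (\<forall>f\<in>a. \<forall>g\<in>b. AE \<omega> in M. cmod (f \<omega>) \<le> cmod (g \<omega>))"

definition disjoint_L0 :: "'a measure \<Rightarrow> ('a \<Rightarrow> complex) set \<Rightarrow> ('a \<Rightarrow> complex) set \<Rightarrow> bool" where
  "disjoint_L0 M a b \<longleftrightarrow>
     (\<forall>f\<in>a. \<forall>g\<in>b. AE \<omega> in M. min (cmod (f \<omega>)) (cmod (g \<omega>)) = 0)"

definition Linf :: "'a measure \<Rightarrow> ('a \<Rightarrow> complex) set set" where
  "Linf M = {a \<in> L0 M. \<exists>f\<in>a. \<exists>C. AE \<omega> in M. cmod (f \<omega>) \<le> C}"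

definition bounded_fun :: "'a measure \<Rightarrow> ('a \<Rightarrow> complex) set" where
  "bounded_fun M = {f \<in> borel_measurable M. \<exists>C. \<forall>\<omega>\<in>space M. cmod (f \<omega>) \<le> C}"

definition faithful_solid_subalgebra :: "'a measure \<Rightarrow> ('a \<Rightarrow> complex) set set \<Rightarrow> bool" where
  "faithful_solid_subalgebra M E \<longleftrightarrow>
     Linf M \<subseteq> E \<and> E \<subseteq> L0 M \<and>
     (\<forall>a\<in>E. \<forall>b\<in>E. L0_add M a b \<in> E) \<and>
     (\<forall>c. \<forall>a\<in>E. L0_scale M c a \<in> E) \<and>
     (\<forall>a\<in>E. \<forall>b\<in>E. L0_mult M a b \<in> E) \<and>
     (\<forall>a\<in>L0 M. \<forall>b\<in>E. abs_le M a b \<longrightarrow> a \<in> E) \<and>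
     {a \<in> L0 M. \<forall>b\<in>E. disjoint_L0 M a b} = {fun_class M (\<lambda>_. 0)}"

text \<open>
  A section is a partial function, \<open>None\<close> standing for "undefined"; two sections are
  equal iff they have the same domain and the same values there.
\<close>

definition is_section :: "'a measure \<Rightarrow> ('a \<Rightarrow> 'b normed_alg) \<Rightarrow> ('a \<rightharpoonup> 'b) \<Rightarrow> bool" where
  "is_section M \<X> u \<longleftrightarrow> dom u \<subseteq> space M \<and> (AE \<omega> in M. \<omega> \<in> dom u) \<and>
     (\<forall>\<omega>\<in>dom u. the (u \<omega>) \<in> carrier (\<X> \<omega>))"

definition sec_add :: "('a \<Rightarrow> 'b normed_alg) \<Rightarrow> ('a \<rightharpoonup> 'b) \<Rightarrow> ('a \<rightharpoonup> 'b) \<Rightarrow> ('a \<rightharpoonup> 'b)" where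
  "sec_add \<X> u v = (\<lambda>\<omega>. if \<omega> \<in> dom u \<inter> dom v
     then Some (the (u \<omega>) \<oplus>\<^bsub>\<X> \<omega>\<^esub> the (v \<omega>)) else None)"

definition sec_mult :: "('a \<Rightarrow> 'b normed_alg) \<Rightarrow> ('a \<rightharpoonup> 'b) \<Rightarrow> ('a \<rightharpoonup> 'b) \<Rightarrow> ('a \<rightharpoonup> 'b)" where
  "sec_mult \<X> u v = (\<lambda>\<omega>. if \<omega> \<in> dom u \<inter> dom v
     then Some (the (u \<omega>) \<otimes>\<^bsub>\<X> \<omega>\<^esub> the (v \<omega>)) else None)"

definition sec_scale :: "('a \<Rightarrow> 'b normed_alg) \<Rightarrow> ('a \<Rightarrow> complex) \<Rightarrow> ('a \<rightharpoonup> 'b) \<Rightarrow> ('a \<rightharpoonup> 'b)" where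
  "sec_scale \<X> f u = (\<lambda>\<omega>. if \<omega> \<in> dom u then Some (f \<omega> \<odot>\<^bsub>\<X> \<omega>\<^esub> the (u \<omega>)) else None)"

definition sec_nrm :: "('a \<Rightarrow> 'b normed_alg) \<Rightarrow> ('a \<rightharpoonup> 'b) \<Rightarrow> 'a \<Rightarrow> real" where
  "sec_nrm \<X> u = (\<lambda>\<omega>. nrm (\<X> \<omega>) (the (u \<omega>)))"

text \<open>
  The norm of a section in \<open>L\<close> is a function on its domain only (which need not be a measurable
  set), hence measurability with respect to the trace \<open>\<sigma>\<close>-algebra.
\<close>

definition measurable_bundle ::
  "'a measure \<Rightarrow> ('a \<Rightarrow> 'b normed_alg) \<Rightarrow> ('a \<rightharpoonup> 'b) set \<Rightarrow> bool" where
  "measurable_bundle M \<X> L \<longleftrightarrow>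
     (\<forall>\<omega>\<in>space M. banach_algebra (\<X> \<omega>) \<and> carrier (\<X> \<omega>) \<noteq> {\<zero>\<^bsub>\<X> \<omega>\<^esub>}) \<and>
     (\<forall>c\<in>L. is_section M \<X> c) \<and>
     (\<forall>k\<^sub>1 k\<^sub>2. \<forall>c\<^sub>1\<in>L. \<forall>c\<^sub>2\<in>L.
        sec_add \<X> (sec_scale \<X> (\<lambda>_. k\<^sub>1) c\<^sub>1) (sec_scale \<X> (\<lambda>_. k\<^sub>2) c\<^sub>2) \<in> L) \<and>
     (\<forall>c\<in>L. sec_nrm \<X> c \<in> borel_measurable (restrict_space M (dom c))) \<and>
     (\<forall>\<omega>\<in>space M. dense_in (\<X> \<omega>) {the (c \<omega>) | c. c \<in> L \<and> \<omega> \<in> dom c}) \<and>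
     (\<forall>u\<in>L. \<forall>v\<in>L. sec_mult \<X> u v \<in> L)"

definition simple_section ::
  "'a measure \<Rightarrow> ('a \<Rightarrow> 'b normed_alg) \<Rightarrow> ('a \<rightharpoonup> 'b) set \<Rightarrow> ('a \<rightharpoonup> 'b) \<Rightarrow> bool" where
  "simple_section M \<X> L s \<longleftrightarrow> (\<exists>(n::nat) A c. n \<ge> 1 \<and>
     (\<forall>i\<in>{1..n}. A i \<in> sets M \<and> c i \<in> L) \<and>
     s = (\<lambda>\<omega>. if \<forall>i\<in>{1..n}. \<omega> \<in> dom (c i)
            then Some (\<Oplus>\<^bsub>\<X> \<omega>\<^esub>i\<in>{1..n}. indicator (A i) \<omega> \<odot>\<^bsub>\<X> \<omega>\<^esub> the (c i \<omega>))
            else None))"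

definition meas_sections ::
  "'a measure \<Rightarrow> ('a \<Rightarrow> 'b normed_alg) \<Rightarrow> ('a \<rightharpoonup> 'b) set \<Rightarrow> ('a \<rightharpoonup> 'b) set" where
  "meas_sections M \<X> L = {u. is_section M \<X> u \<and>
     (\<exists>s. (\<forall>n::nat. simple_section M \<X> L (s n)) \<and>
        (AE \<omega> in M. \<omega> \<in> dom u \<and> (\<forall>n. \<omega> \<in> dom (s n)) \<and>
           (\<lambda>n. nrm (\<X> \<omega>) (the (s n \<omega>) \<ominus>\<^bsub>\<X> \<omega>\<^esub> the (u \<omega>))) \<longlonglongrightarrow> 0))}"

definition sec_class ::
  "'a measure \<Rightarrow> ('a \<Rightarrow> 'b normed_alg) \<Rightarrow> ('a \<rightharpoonup> 'b) set \<Rightarrow> ('a \<rightharpoonup> 'b) \<Rightarrow> ('a \<rightharpoonup> 'b) set" where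
  "sec_class M \<X> L u = {v \<in> meas_sections M \<X> L. AE \<omega> in M. v \<omega> = u \<omega>}"

definition L0_sec ::
  "'a measure \<Rightarrow> ('a \<Rightarrow> 'b normed_alg) \<Rightarrow> ('a \<rightharpoonup> 'b) set \<Rightarrow> ('a \<rightharpoonup> 'b) set set" where
  "L0_sec M \<X> L = sec_class M \<X> L ` meas_sections M \<X> L"

definition class_add :: "'a measure \<Rightarrow> ('a \<Rightarrow> 'b normed_alg) \<Rightarrow> ('a \<rightharpoonup> 'b) set
    \<Rightarrow> ('a \<rightharpoonup> 'b) set \<Rightarrow> ('a \<rightharpoonup> 'b) set \<Rightarrow> ('a \<rightharpoonup> 'b) set" where
  "class_add M \<X> L x y = (\<Union>u\<in>x. \<Union>v\<in>y. sec_class M \<X> L (sec_add \<X> u v))"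

definition class_mult :: "'a measure \<Rightarrow> ('a \<Rightarrow> 'b normed_alg) \<Rightarrow> ('a \<rightharpoonup> 'b) set
    \<Rightarrow> ('a \<rightharpoonup> 'b) set \<Rightarrow> ('a \<rightharpoonup> 'b) set \<Rightarrow> ('a \<rightharpoonup> 'b) set" where
  "class_mult M \<X> L x y = (\<Union>u\<in>x. \<Union>v\<in>y. sec_class M \<X> L (sec_mult \<X> u v))"

definition class_scale :: "'a measure \<Rightarrow> ('a \<Rightarrow> 'b normed_alg) \<Rightarrow> ('a \<rightharpoonup> 'b) set
    \<Rightarrow> ('a \<Rightarrow> complex) set \<Rightarrow> ('a \<rightharpoonup> 'b) set \<Rightarrow> ('a \<rightharpoonup> 'b) set" where
  "class_scale M \<X> L a x = (\<Union>f\<in>a. \<Union>u\<in>x. sec_class M \<X> L (sec_scale \<X> f u))"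

definition class_nrm ::
  "'a measure \<Rightarrow> ('a \<Rightarrow> 'b normed_alg) \<Rightarrow> ('a \<rightharpoonup> 'b) set \<Rightarrow> ('a \<Rightarrow> complex) set" where
  "class_nrm M \<X> x = (\<Union>u\<in>x. fun_class M (\<lambda>\<omega>. complex_of_real (sec_nrm \<X> u \<omega>)))"

definition E_sec :: "'a measure \<Rightarrow> ('a \<Rightarrow> complex) set set \<Rightarrow> ('a \<Rightarrow> 'b normed_alg)
    \<Rightarrow> ('a \<rightharpoonup> 'b) set \<Rightarrow> ('a \<rightharpoonup> 'b) set set" where
  "E_sec M E \<X> L = {x \<in> L0_sec M \<X> L. class_nrm M \<X> x \<in> E}"

definition bounded_sec ::
  "'a measure \<Rightarrow> ('a \<Rightarrow> 'b normed_alg) \<Rightarrow> ('a \<rightharpoonup> 'b) set \<Rightarrow> ('a \<rightharpoonup> 'b) set" where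
  "bounded_sec M \<X> L = {u \<in> meas_sections M \<X> L. dom u = space M \<and>
     (\<lambda>\<omega>. complex_of_real (sec_nrm \<X> u \<omega>)) \<in> bounded_fun M}"

definition normalized_unit :: "'a measure \<Rightarrow> ('a \<Rightarrow> complex) set set \<Rightarrow> ('a \<Rightarrow> 'b normed_alg)
    \<Rightarrow> ('a \<rightharpoonup> 'b) set \<Rightarrow> ('a \<rightharpoonup> 'b) set \<Rightarrow> bool" where
  "normalized_unit M E \<X> L e \<longleftrightarrow> e \<in> E_sec M E \<X> L \<and> class_nrm M \<X> e = L0_one M \<and>
     (\<forall>x\<in>E_sec M E \<X> L. class_mult M \<X> L e x = x \<and> class_mult M \<X> L x e = x)"

definition class_support ::
  "'a measure \<Rightarrow> ('a \<Rightarrow> 'b normed_alg) \<Rightarrow> ('a \<rightharpoonup> 'b) set \<Rightarrow> ('a \<Rightarrow> complex) set" where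
  "class_support M \<X> x =
     (\<Union>g\<in>class_nrm M \<X> x. fun_class M (indicator {\<omega> \<in> space M. g \<omega> \<noteq> 0}))"

definition isometrically_isomorphic :: "'a measure \<Rightarrow> ('a \<Rightarrow> complex) set set
    \<Rightarrow> ('a \<Rightarrow> 'b normed_alg) \<Rightarrow> ('a \<rightharpoonup> 'b) set \<Rightarrow> bool" where
  "isometrically_isomorphic M E \<X> L \<longleftrightarrow> (\<exists>\<phi>. bij_betw \<phi> (E_sec M E \<X> L) E \<and>
     (\<forall>x\<in>E_sec M E \<X> L. \<forall>y\<in>E_sec M E \<X> L.
        \<phi> (class_add M \<X> L x y) = L0_add M (\<phi> x) (\<phi> y) \<and>
        \<phi> (class_mult M \<X> L x y) = L0_mult M (\<phi> x) (\<phi> y)) \<and>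
     (\<forall>a\<in>E. \<forall>x\<in>E_sec M E \<X> L. \<phi> (class_scale M \<X> L a x) = L0_mult M a (\<phi> x)) \<and>
     (\<forall>x\<in>E_sec M E \<X> L. L0_abs M (\<phi> x) = class_nrm M \<X> x))"

text \<open>
  The norms are compared in \<open>ennreal\<close>, where the supremum over an empty space and the essential
  supremum over a null space are \<open>0\<close>.
\<close>

definition lifting :: "'a measure \<Rightarrow> (('a \<Rightarrow> complex) set \<Rightarrow> ('a \<Rightarrow> complex)) \<Rightarrow> bool" where
  "lifting M p \<longleftrightarrow>
     (\<forall>a\<in>Linf M. p a \<in> bounded_fun M \<and> p a \<in> a) \<and>
     (\<forall>\<omega>\<in>space M. p (L0_one M) \<omega> = 1) \<and>
     (\<forall>a\<in>Linf M. \<forall>b\<in>Linf M. \<forall>\<omega>\<in>space M.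
        p (L0_add M a b) \<omega> = p a \<omega> + p b \<omega> \<and>
        p (L0_mult M a b) \<omega> = p a \<omega> * p b \<omega>) \<and>
     (\<forall>c. \<forall>a\<in>Linf M. \<forall>\<omega>\<in>space M. p (L0_scale M c a) \<omega> = c * p a \<omega>) \<and>
     (\<forall>a\<in>Linf M. \<forall>\<omega>\<in>space M. p (L0_cnj M a) \<omega> = cnj (p a \<omega>)) \<and>
     (\<forall>a\<in>Linf M. \<forall>f\<in>a. (SUP \<omega>\<in>space M. ennreal (cmod (p a \<omega>)))
        = esssup M (\<lambda>\<omega>. ennreal (cmod (f \<omega>))))"

definition vector_lifting ::
  "'a measure \<Rightarrow> ('a \<Rightarrow> 'b normed_alg) \<Rightarrow> ('a \<rightharpoonup> 'b) set
    \<Rightarrow> (('a \<Rightarrow> complex) set \<Rightarrow> ('a \<Rightarrow> complex)) \<Rightarrow> (('a \<rightharpoonup> 'b) set \<Rightarrow> ('a \<rightharpoonup> 'b)) \<Rightarrow> bool" where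
  "vector_lifting M \<X> L p ell \<longleftrightarrow>
     (\<forall>x\<in>E_sec M (Linf M) \<X> L. ell x \<in> bounded_sec M \<X> L \<and>
        ell x \<in> x \<and> dom (ell x) = space M \<and>
        (\<forall>\<omega>\<in>space M. complex_of_real (sec_nrm \<X> (ell x) \<omega>) = p (class_nrm M \<X> x) \<omega>)) \<and>
     (\<forall>x\<in>E_sec M (Linf M) \<X> L. \<forall>y\<in>E_sec M (Linf M) \<X> L.
        ell (class_add M \<X> L x y) = sec_add \<X> (ell x) (ell y)) \<and>
     (\<forall>a\<in>Linf M. \<forall>x\<in>E_sec M (Linf M) \<X> L.
        ell (class_scale M \<X> L a x) = sec_scale \<X> (p a) (ell x)) \<and>
     (\<forall>x\<in>E_sec M (Linf M) \<X> L. \<forall>y\<in>E_sec M (Linf M) \<X> L.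
        ell (class_mult M \<X> L x y) = sec_mult \<X> (ell x) (ell y)) \<and>
     (\<forall>\<omega>\<in>space M. dense_in (\<X> \<omega>) {the (ell x \<omega>) | x. x \<in> E_sec M (Linf M) \<X> L})"

end

theory Submission
  imports Defs
begin

text \<open>
  Let \<open>e\<close> be the unit and let \<open>u\<close> be a section. For every scalar function \<open>f\<close> in \<open>E\<close>, adding \<open>e\<close> on the
  set where \<open>u + f e\<close> vanishes yields an element of unit support, so that \<open>u + f e\<close> is invertible in
  almost every fibre in which it does not vanish. By a version of the Gelfand--Mazur theorem, the
  resolvent norms of \<open>u(\<omega>)\<close> on a fixed countable set of scalars are unbounded. Hence one can choose
  measurable scalar functions at which the resolvent of \<open>u\<close> is undefined or has norm at least \<open>k\<close>;
  they are bounded by \<open>\<parallel>u\<parallel> + 1\<close>, and along a measurable choice of indices they converge to some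
  \<open>a\<close> in \<open>E\<close>. In no fibre is \<open>u - a e\<close> invertible, so it vanishes almost everywhere: every element is
  of the form \<open>a e\<close>.

  The Gelfand--Mazur argument is Rickart's elementary one: if the resolvent were bounded, it would
  be uniformly continuous, and averaging \<open>(1 - c x / r)\<^sup>-\<^sup>1\<close> over \<open>2 ^ k\<close>-th roots of unity \<open>c\<close>,
  which gives \<open>(1 - (x / r) ^ 2 ^ k)\<^sup>-\<^sup>1\<close>, would make these elements close to each other for \<open>r\<close>
  just below and just above the spectral radius.
\<close>

section \<open>Unbounded resolvents\<close>

text \<open>The hypothesis speaks of global sections, so every application of it costs a null set.
  Fibrewise spectra are therefore visible only through countably many scalar functions, while the
  spectral value in a given fibre need not be among countably many candidates. This forces the
  detour: at the test scalars one can only ask for large resolvents, not for failure of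
  invertibility, and the limit \<open>a\<close> is tested afterwards by one more application of the
  hypothesis to that single function. A large inverse \<open>w\<close> of u + c e is an approximate
  eigenvector, since (u + c e) w = e is small relative to \<open>w\<close>; this smallness passes to
  the limit and excludes an inverse there. Rickart's argument suits the situation because it
  compares resolvents only at dyadic roots of unity on two circles of rational radius: boundedness
  on a countable set of scalars is already contradictory, and no resolvent outside that set is ever
  formed.\<close>

context banach_algebra
begin

lemma sc_closed [simp, intro]: "x \<in> carrier A \<Longrightarrow> c \<odot> x \<in> carrier A"
  by (rule smult_closed) (simp add: ring_of_type_algebra_def)

lemma sc_l_distr: "x \<in> carrier A \<Longrightarrow> (a + b) \<odot> x = a \<odot> x \<oplus> b \<odot> x"
  using smult_l_distr[of a b x] by (simp add: ring_of_type_algebra_def)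

lemma sc_r_distr: "\<lbrakk>x \<in> carrier A; y \<in> carrier A\<rbrakk> \<Longrightarrow> a \<odot> (x \<oplus> y) = a \<odot> x \<oplus> a \<odot> y"
  using smult_r_distr[of a x y] by (simp add: ring_of_type_algebra_def)

lemma sc_assoc [simp]: "x \<in> carrier A \<Longrightarrow> a \<odot> (b \<odot> x) = (a * b) \<odot> x"
  using smult_assoc1[of a b x] by (simp add: ring_of_type_algebra_def)

lemma sc_one [simp]: "x \<in> carrier A \<Longrightarrow> 1 \<odot> x = x"
  using smult_one[of x] by (simp add: ring_of_type_algebra_def)

lemma sc_zero [simp]: "x \<in> carrier A \<Longrightarrow> 0 \<odot> x = \<zero>"
  using smult_l_null[of x] by (simp add: ring_of_type_algebra_def)

lemma sc_neg: "x \<in> carrier A \<Longrightarrow> (- c) \<odot> x = \<ominus> (c \<odot> x)"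
  by (metis M.minus_equality add.left_inverse sc_closed sc_l_distr sc_zero)

lemma neg_eq_sc: "x \<in> carrier A \<Longrightarrow> \<ominus> x = (- 1) \<odot> x"
  by (simp add: sc_neg)

lemma minus_eq_sc: "\<lbrakk>x \<in> carrier A; y \<in> carrier A\<rbrakk> \<Longrightarrow> x \<ominus> y = x \<oplus> (- 1) \<odot> y"
  by (simp add: M.minus_eq neg_eq_sc)

lemma sc_minus: "\<lbrakk>x \<in> carrier A; y \<in> carrier A\<rbrakk> \<Longrightarrow> c \<odot> (x \<ominus> y) = c \<odot> x \<ominus> c \<odot> y"
  by (simp add: minus_eq_sc sc_r_distr)

lemma add_minus_add_cancel:
  assumes [simp]: "x \<in> carrier A" "y \<in> carrier A" "z \<in> carrier A"
  shows "(x \<oplus> y) \<ominus> (x \<oplus> z) = y \<ominus> z"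
proof -
  have "(x \<oplus> y) \<ominus> (x \<oplus> z) = (x \<oplus> \<ominus> x) \<oplus> (y \<oplus> \<ominus> z)"
    unfolding M.minus_eq by (simp add: M.minus_add M.a_ac)
  then show ?thesis
    by (simp add: M.r_neg M.minus_eq)
qed

lemma add_add_neg_cancel: "\<lbrakk>x \<in> carrier A; y \<in> carrier A\<rbrakk> \<Longrightarrow> x \<oplus> (y \<oplus> \<ominus> x) = y"
  by (simp add: M.a_lcomm[of x y] M.r_neg)

lemma nrm_zero [simp]: "nrm A \<zero> = 0"
  by (simp add: nrm_eq_0_iff)

lemma nrm_neg [simp]: "x \<in> carrier A \<Longrightarrow> nrm A (\<ominus> x) = nrm A x"
  by (simp add: neg_eq_sc nrm_smult)

lemma nrm_minus_le: "\<lbrakk>x \<in> carrier A; y \<in> carrier A\<rbrakk> \<Longrightarrow> nrm A (x \<ominus> y) \<le> nrm A x + nrm A y"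
  using nrm_triangle[of x "\<ominus> y"] by (simp add: M.minus_eq)

lemma mult_closed' [simp, intro]: "\<lbrakk>x \<in> carrier A; y \<in> carrier A\<rbrakk> \<Longrightarrow> x \<otimes> y \<in> carrier A"
  by (rule mult_closed)

lemma mult_neg_r: "\<lbrakk>x \<in> carrier A; y \<in> carrier A\<rbrakk> \<Longrightarrow> x \<otimes> (\<ominus> y) = \<ominus> (x \<otimes> y)"
  by (simp add: neg_eq_sc smult_mult_r)

lemma mult_neg_l: "\<lbrakk>x \<in> carrier A; y \<in> carrier A\<rbrakk> \<Longrightarrow> (\<ominus> x) \<otimes> y = \<ominus> (x \<otimes> y)"
  by (simp add: neg_eq_sc smult_mult_l)

end

text \<open>
  The idempotent \<open>e\<close> need not be a unit of the algebra; it is the unit of \<open>corner\<close>, where all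
  inverses are taken.
\<close>

locale pointed_banach_algebra = banach_algebra A for A :: "'b normed_alg" (structure) +
  fixes e
  assumes e_closed [simp, intro]: "e \<in> carrier A" and e_idem [simp]: "e \<otimes> e = e"
    and nrm_e [simp]: "nrm A e = 1"
begin

definition corner :: "'b set" where
  "corner = {x \<in> carrier A. e \<otimes> x = x \<and> x \<otimes> e = x}"

definition inv_pair :: "'b \<Rightarrow> 'b \<Rightarrow> bool" where
  "inv_pair x w \<longleftrightarrow> w \<in> corner \<and> x \<otimes> w = e \<and> w \<otimes> x = e"

lemma cornerI: "\<lbrakk>x \<in> carrier A; e \<otimes> x = x; x \<otimes> e = x\<rbrakk> \<Longrightarrow> x \<in> corner"
  by (simp add: corner_def)

lemma cornerD [simp]:
  assumes "x \<in> corner"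
  shows "x \<in> carrier A" "e \<otimes> x = x" "x \<otimes> e = x"
  using assms by (auto simp: corner_def)

lemma corner_e [simp]: "e \<in> corner"
  by (rule cornerI) auto

lemma corner_add [simp]: "\<lbrakk>x \<in> corner; y \<in> corner\<rbrakk> \<Longrightarrow> x \<oplus> y \<in> corner"
  by (rule cornerI) (simp_all add: distr_l distr_r)

lemma corner_sc [simp]: "x \<in> corner \<Longrightarrow> c \<odot> x \<in> corner"
  by (rule cornerI) (simp_all add: smult_mult_l smult_mult_r)

lemma corner_neg [simp]: "x \<in> corner \<Longrightarrow> \<ominus> x \<in> corner"
  by (simp add: neg_eq_sc)

lemma corner_minus [simp]: "\<lbrakk>x \<in> corner; y \<in> corner\<rbrakk> \<Longrightarrow> x \<ominus> y \<in> corner"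
  by (simp add: M.minus_eq)

lemma corner_mult [simp]: "\<lbrakk>x \<in> corner; y \<in> corner\<rbrakk> \<Longrightarrow> x \<otimes> y \<in> corner"
  using mult_assoc[of e x y] mult_assoc[of x y e] by (intro cornerI) simp_all

lemma inv_pair_closed [simp]: "inv_pair x w \<Longrightarrow> w \<in> corner" "inv_pair x w \<Longrightarrow> w \<in> carrier A"
  by (auto simp: inv_pair_def)

text \<open>Partial fractions: 1/(1 - p^2) is the mean of 1/(1 - p) and 1/(1 + p). No commutativity
  of the algebra is required, since \<open>p\<close> commutes with e - p and e + p. This is one
  doubling step in the average over roots of unity.\<close>

lemma inv_pair_square:
  assumes p: "p \<in> corner" and 1: "inv_pair (e \<ominus> p) w" and 2: "inv_pair (e \<oplus> p) v"
  shows "inv_pair (e \<ominus> p \<otimes> p) ((1/2) \<odot> (w \<oplus> v))"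
proof -
  have w: "w \<in> corner" "(e \<ominus> p) \<otimes> w = e" "w \<otimes> (e \<ominus> p) = e"
    and v: "v \<in> corner" "(e \<oplus> p) \<otimes> v = e" "v \<otimes> (e \<oplus> p) = e"
    using 1 2 by (auto simp: inv_pair_def)
  have f1: "e \<ominus> p \<otimes> p = (e \<oplus> p) \<otimes> (e \<ominus> p)" and f2: "e \<ominus> p \<otimes> p = (e \<ominus> p) \<otimes> (e \<oplus> p)"
    using p by (simp_all add: distr_l distr_r M.minus_eq mult_neg_r mult_neg_l M.a_ac M.r_neg1 M.r_neg2 M.minus_add)
  have two: "(e \<oplus> p) \<oplus> (e \<ominus> p) = 2 \<odot> e"
    using p sc_l_distr[of e 1 1] by (simp add: M.minus_eq M.a_ac M.r_neg1 M.r_neg2 M.r_neg)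
  have a: "(e \<ominus> p \<otimes> p) \<otimes> w = e \<oplus> p"
    unfolding f1 using p w by (simp add: mult_assoc)
  have b: "(e \<ominus> p \<otimes> p) \<otimes> v = e \<ominus> p"
    unfolding f2 using p v by (simp add: mult_assoc)
  have c: "w \<otimes> (e \<ominus> p \<otimes> p) = e \<oplus> p"
    unfolding f2 using p w by (simp flip: mult_assoc)
  have d: "v \<otimes> (e \<ominus> p \<otimes> p) = e \<ominus> p"
    unfolding f1 using p v by (simp flip: mult_assoc)
  show ?thesis
    unfolding inv_pair_def using p w(1) v(1) a b c d two
    by (simp add: smult_mult_l smult_mult_r distr_l distr_r)
qed

lemma nrm_pos_if_inv_pair:
  assumes "inv_pair x w" "x \<in> carrier A"
  shows "nrm A w > 0"
proof -
  have "1 \<le> nrm A x * nrm A w"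
    using nrm_mult[of x w] assms by (auto simp: inv_pair_def)
  then show ?thesis
    using nrm_nonneg[of w] assms by (cases "nrm A w = 0") (auto simp: inv_pair_def)
qed

text \<open>The resolvent identity w - v = (b - a) w v. The common bound \<open>N\<close> makes the
  Lipschitz constant independent of the two scalars.\<close>

lemma resolvent_lipschitz:
  assumes x: "x \<in> corner" and w: "inv_pair (x \<oplus> a \<odot> e) w" and v: "inv_pair (x \<oplus> b \<odot> e) v"
    and N: "nrm A w \<le> N" "nrm A v \<le> N"
  shows "nrm A (w \<ominus> v) \<le> cmod (a - b) * N\<^sup>2"
proof -
  have c: "w \<in> corner" "v \<in> corner" using w v by auto
  have eq: "w \<ominus> v = (b - a) \<odot> (w \<otimes> v)"
  proof -
    have "w = w \<otimes> ((x \<oplus> b \<odot> e) \<otimes> v)" and "v = (w \<otimes> (x \<oplus> a \<odot> e)) \<otimes> v"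
      using c w v by (simp_all add: inv_pair_def)
    then have "w \<ominus> v = w \<otimes> ((x \<oplus> b \<odot> e) \<otimes> v) \<ominus> (w \<otimes> (x \<oplus> a \<odot> e)) \<otimes> v"
      by simp
    also have "\<dots> = w \<otimes> (x \<otimes> v) \<oplus> b \<odot> (w \<otimes> v) \<ominus> (w \<otimes> (x \<otimes> v) \<oplus> a \<odot> (w \<otimes> v))"
      using c x by (simp add: distr_l distr_r smult_mult_l smult_mult_r mult_assoc)
    also have "\<dots> = b \<odot> (w \<otimes> v) \<oplus> (- a) \<odot> (w \<otimes> v)"
      using c x by (subst add_minus_add_cancel) (simp_all add: M.minus_eq sc_neg)
    also have "\<dots> = (b - a) \<odot> (w \<otimes> v)"
      using c by (simp flip: sc_l_distr)
    finally show ?thesis .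
  qed
  have "nrm A (w \<otimes> v) \<le> N * N"
    using order_trans[OF nrm_mult[of w v] mult_mono[OF N]] N nrm_nonneg[of w] nrm_nonneg[of v] c
    by simp
  then show ?thesis
    unfolding eq using c
    by (simp add: nrm_smult power2_eq_square norm_minus_commute mult_left_mono)
qed

end

text \<open>
  Inverses of measurable sections are controlled only almost everywhere, so spectra may be tested
  at countably many scalars only. The following set suffices because the dyadic roots of unity
  are closed under square roots.
\<close>

definition dyadic_roots :: "complex set" where
  "dyadic_roots = {c. \<exists>j. c ^ (2 ^ j) = 1}"

text \<open>Rational radii suffice because the argument needs just one circle on each side of the
  spectral radius, close to it. The rational 0 puts the scalar 0 into the set, at which the
  invertibility of \<open>x\<close> itself is tested.\<close>

definition test_scalars :: "complex set" where
  "test_scalars = {c * of_real (real_of_rat q) | c q. c \<in> dyadic_roots}"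

lemma countable_test_scalars: "countable test_scalars"
proof -
  have "dyadic_roots = (\<Union>j. {c. c ^ (2 ^ j) = 1})"
    by (auto simp: dyadic_roots_def)
  moreover have "countable (\<Union>j::nat. {c::complex. c ^ (2 ^ j) = 1})"
    by (intro countable_UN countableI_type countable_finite finite_roots_unity) simp
  ultimately have "countable dyadic_roots" by simp
  moreover have "test_scalars = (\<lambda>(c, q). c * of_real (real_of_rat q)) ` (dyadic_roots \<times> UNIV)"
    by (auto simp: test_scalars_def)
  ultimately show ?thesis by (metis countable_SIGMA countable_image countableI_type)
qed

lemma dyadic_roots_sqrt: "c\<^sup>2 \<in> dyadic_roots \<Longrightarrow> c \<in> dyadic_roots"
  unfolding dyadic_roots_def by (auto simp flip: power_mult power_Suc)

lemma dyadic_roots_neg: "c \<in> dyadic_roots \<Longrightarrow> - c \<in> dyadic_roots"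
proof -
  assume "c \<in> dyadic_roots"
  then obtain j where "c ^ 2 ^ j = 1" by (auto simp: dyadic_roots_def)
  then have "c ^ 2 ^ Suc j = 1" by (metis power_Suc2 power_mult power_one)
  then have "(- c) ^ 2 ^ Suc j = 1" by simp
  then show ?thesis
    unfolding dyadic_roots_def by blast
qed

lemma dyadic_roots_inverse: "c \<in> dyadic_roots \<Longrightarrow> inverse c \<in> dyadic_roots"
  by (auto simp: dyadic_roots_def power_inverse)

lemma dyadic_roots_norm:
  assumes "c \<in> dyadic_roots"
  shows "norm c = 1"
proof -
  obtain j where "c ^ 2 ^ j = 1" using assms by (auto simp: dyadic_roots_def)
  then show ?thesis using power_eq_1_iff by fastforce
qed

lemma test_scalars_zero: "0 \<in> test_scalars"
proof -
  have "1 \<in> dyadic_roots" by (simp add: dyadic_roots_def)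
  then show ?thesis unfolding test_scalars_def by (force intro: exI[of _ 0])
qed

section \<open>Rickart's averaging argument and approximate eigenvectors\<close>

context pointed_banach_algebra
begin

primrec iter_sq :: "'b \<Rightarrow> nat \<Rightarrow> 'b" where
  "iter_sq x 0 = x"
| "iter_sq x (Suc k) = iter_sq x k \<otimes> iter_sq x k"

lemma iter_sq_corner [simp]: "x \<in> corner \<Longrightarrow> iter_sq x k \<in> corner"
  by (induction k) auto

lemma iter_sq_sc: "x \<in> corner \<Longrightarrow> iter_sq (a \<odot> x) k = (a ^ 2 ^ k) \<odot> iter_sq x k"
  by (induction k) (simp_all add: smult_mult_l smult_mult_r power_mult power2_eq_square power_mult_distrib)

text \<open>By submultiplicativity such a bound, once valid at one stage, survives every further
  squaring. A single \<open>k\<close> thus certifies that \<open>t\<close> is not below the spectral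
  radius.\<close>

lemma nrm_iter_sq_le:
  assumes x: "x \<in> corner" and t: "nrm A (iter_sq x k) \<le> t ^ 2 ^ k"
  shows "nrm A (iter_sq x (k + j)) \<le> t ^ 2 ^ (k + j)"
proof (induction j)
  case (Suc j)
  let ?y = "iter_sq x (k + j)"
  have "nrm A (?y \<otimes> ?y) \<le> nrm A ?y * nrm A ?y"
    using x by (intro nrm_mult) auto
  also have "\<dots> \<le> t ^ 2 ^ (k + j) * t ^ 2 ^ (k + j)"
    using x by (intro mult_mono Suc nrm_nonneg) (auto intro: order_trans[OF nrm_nonneg Suc])
  finally show ?case by (simp add: power_mult power2_eq_square power_mult_distrib)
qed (use t in simp)

lemma inv_pair_iter_sq:
  assumes "x \<in> corner" "inv_pair x w"
  shows "inv_pair (iter_sq x k) (iter_sq w k)"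
proof (induction k)
  case (Suc k)
  let ?x = "iter_sq x k" and ?w = "iter_sq w k"
  have [simp]: "?x \<in> corner" "?w \<in> corner" and *: "?x \<otimes> ?w = e" "?w \<otimes> ?x = e"
    using assms Suc by (auto simp: inv_pair_def)
  have "(?x \<otimes> ?x) \<otimes> (?w \<otimes> ?w) = ?x \<otimes> ((?x \<otimes> ?w) \<otimes> ?w)"
    and "(?w \<otimes> ?w) \<otimes> (?x \<otimes> ?x) = ?w \<otimes> ((?w \<otimes> ?x) \<otimes> ?x)"
    by (simp_all add: mult_assoc)
  then show ?case
    using * by (simp add: inv_pair_def)
qed (use assms in simp)

lemma inv_pair_sc:
  assumes "inv_pair x w" "x \<in> carrier A" "a \<noteq> 0"
  shows "inv_pair (a \<odot> x) ((1 / a) \<odot> w)"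
  using assms by (auto simp: inv_pair_def smult_mult_l smult_mult_r)

text \<open>
  Rickart's averaging argument with \<open>2 ^ k\<close> roots of unity, done one square root at a time:
  estimates that are uniform over \<open>dyadic_roots\<close> survive squaring.
\<close>

lemma inv_pair_iterate:
  assumes y: "y \<in> corner" and z: "z \<in> corner"
    and base: "\<And>c. c \<in> dyadic_roots \<Longrightarrow>
      \<exists>w v. inv_pair (e \<ominus> c \<odot> y) w \<and> inv_pair (e \<ominus> c \<odot> z) v \<and> nrm A (w \<ominus> v) \<le> \<epsilon>"
    and c: "c \<in> dyadic_roots"
  shows "\<exists>w v. inv_pair (e \<ominus> c \<odot> iter_sq y k) w \<and> inv_pair (e \<ominus> c \<odot> iter_sq z k) v
           \<and> nrm A (w \<ominus> v) \<le> \<epsilon>"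
  using c
proof (induction k arbitrary: c)
  case 0
  then show ?case using base by simp
next
  case (Suc k)
  \<comment> \<open>Both square roots d and -d of c are dyadic roots again, so the induction
    hypothesis inverts both factors of e - c p^2 = (e - d p)(e + d p), for p = \<open>?y\<close> and
    for p = \<open>?z\<close>.\<close>
  define d where "d = csqrt c"
  have d2: "d * d = c" by (simp add: d_def flip: power2_eq_square)
  have d: "d \<in> dyadic_roots" "- d \<in> dyadic_roots"
    using Suc.prems dyadic_roots_sqrt[of d] dyadic_roots_neg by (auto simp: d_def)
  let ?y = "iter_sq y k" and ?z = "iter_sq z k"
  obtain w\<^sub>1 v\<^sub>1 where 1: "inv_pair (e \<ominus> d \<odot> ?y) w\<^sub>1" "inv_pair (e \<ominus> d \<odot> ?z) v\<^sub>1"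
      "nrm A (w\<^sub>1 \<ominus> v\<^sub>1) \<le> \<epsilon>"
    using Suc.IH[OF d(1)] by auto
  obtain w\<^sub>2 v\<^sub>2 where 2: "inv_pair (e \<oplus> d \<odot> ?y) w\<^sub>2" "inv_pair (e \<oplus> d \<odot> ?z) v\<^sub>2"
      "nrm A (w\<^sub>2 \<ominus> v\<^sub>2) \<le> \<epsilon>"
    using Suc.IH[OF d(2)] y z by (auto simp: M.minus_eq sc_neg)
  have [simp]: "w\<^sub>1 \<in> carrier A" "v\<^sub>1 \<in> carrier A" "w\<^sub>2 \<in> carrier A" "v\<^sub>2 \<in> carrier A"
    using 1 2 inv_pair_closed(2) by blast+
  have sq: "(d \<odot> u) \<otimes> (d \<odot> u) = c \<odot> (u \<otimes> u)" if "u \<in> corner" for u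
    using that d2 by (simp add: smult_mult_l smult_mult_r)
  have "inv_pair (e \<ominus> c \<odot> (?y \<otimes> ?y)) ((1/2) \<odot> (w\<^sub>1 \<oplus> w\<^sub>2))"
    and "inv_pair (e \<ominus> c \<odot> (?z \<otimes> ?z)) ((1/2) \<odot> (v\<^sub>1 \<oplus> v\<^sub>2))"
    using inv_pair_square[of "d \<odot> ?y" w\<^sub>1 w\<^sub>2] inv_pair_square[of "d \<odot> ?z" v\<^sub>1 v\<^sub>2] 1 2 y z
    by (simp_all add: sq)
  \<comment> \<open>The factor 1/2 absorbs the sum of the two errors; this is why \<epsilon> does
    not grow with \<open>k\<close>.\<close>
  moreover have "nrm A ((1/2) \<odot> (w\<^sub>1 \<oplus> w\<^sub>2) \<ominus> (1/2) \<odot> (v\<^sub>1 \<oplus> v\<^sub>2)) \<le> \<epsilon>"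
  proof -
    have "(1/2) \<odot> (w\<^sub>1 \<oplus> w\<^sub>2) \<ominus> (1/2) \<odot> (v\<^sub>1 \<oplus> v\<^sub>2)
        = (1/2) \<odot> ((w\<^sub>1 \<ominus> v\<^sub>1) \<oplus> (w\<^sub>2 \<ominus> v\<^sub>2))"
      by (subst sc_minus[symmetric]) (simp_all add: M.minus_eq M.minus_add M.a_ac)
    then show ?thesis
      using nrm_triangle[of "w\<^sub>1 \<ominus> v\<^sub>1" "w\<^sub>2 \<ominus> v\<^sub>2"] 1(3) 2(3) by (simp add: nrm_smult)
  qed
  ultimately show ?case by auto
qed

text \<open>From w = e + w y and norm of y at most 1/5 one gets norm of w at most 5/4, hence w is
  within 1/4 of e and v within 1/4 + 1/8 = 3/8. Put d = v - e. Then z = d - z d bounds the norm of z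
  by (3/8) / (1 - 3/8) = 3/5. The constants only have to keep the distance from v to e below
  1/2.\<close>

lemma nrm_less_one_if_close_to_small:
  assumes y: "y \<in> corner" "inv_pair (e \<ominus> y) w" and z: "z \<in> corner" "inv_pair (e \<ominus> z) v"
    and close: "nrm A (w \<ominus> v) \<le> 1/8" and small: "nrm A y \<le> 1/5"
  shows "nrm A z < 1"
proof -
  have [simp]: "w \<in> corner" "v \<in> corner" using y z by auto
  have "w \<ominus> w \<otimes> y = e"
    using y by (simp add: inv_pair_def M.minus_eq distr_r mult_neg_r)
  then have w: "w = e \<oplus> w \<otimes> y"
    using y(1) by (metis M.add.inv_solve_right M.minus_eq cornerD(1) corner_e corner_mult M.add.inv_closed \<open>w \<in> corner\<close>)
  have "v \<ominus> z \<otimes> v = e"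
    using z by (simp add: inv_pair_def M.minus_eq distr_l mult_neg_l)
  then have v: "v = e \<oplus> z \<otimes> v"
    using z(1) by (metis M.add.inv_solve_right M.minus_eq cornerD(1) corner_e corner_mult M.add.inv_closed \<open>v \<in> corner\<close>)
  have we: "w \<ominus> e = w \<otimes> y"
    using y(1) by (subst w) (simp add: M.minus_eq M.a_ac M.r_neg1 M.r_neg2)
  define d where "d = v \<ominus> e"
  have [simp]: "d \<in> corner" by (simp add: d_def)
  have vd: "v = e \<oplus> d"
    by (simp add: d_def M.minus_eq M.a_lcomm[of e v] M.r_neg)
  have "d = z \<otimes> v"
    unfolding d_def using z(1) by (subst v) (simp add: M.minus_eq M.a_ac M.r_neg1 M.r_neg2)
  also have "\<dots> = z \<oplus> z \<otimes> d"
    using z(1) by (simp add: vd distr_r)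
  finally have "z = d \<ominus> z \<otimes> d"
    using z(1) by (metis M.add.inv_solve_right M.minus_eq M.add.inv_closed cornerD(1) corner_mult \<open>d \<in> corner\<close>)
  then have "nrm A z \<le> nrm A d + nrm A (z \<otimes> d)"
    using nrm_minus_le[of d "z \<otimes> d"] z(1) by simp
  then have zd: "nrm A z \<le> nrm A d + nrm A z * nrm A d"
    using nrm_mult[of z d] z(1) by simp
  have wy: "nrm A (w \<otimes> y) \<le> nrm A w * (1/5)"
    using nrm_mult[of w y] mult_left_mono[OF small nrm_nonneg[of w]] y(1) by simp
  have "nrm A w \<le> 1 + nrm A (w \<otimes> y)"
    using nrm_triangle[of e "w \<otimes> y"] y(1) w by simp
  then have "nrm A (w \<ominus> e) \<le> 1/4"
    using wy we by simp
  moreover have "d = (w \<ominus> e) \<ominus> (w \<ominus> v)"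
    by (simp add: d_def M.minus_eq M.minus_add M.a_ac M.r_neg1 M.r_neg2 add_add_neg_cancel)
  ultimately have "nrm A d \<le> 3/8"
    using nrm_minus_le[of "w \<ominus> e" "w \<ominus> v"] close by simp
  then have "nrm A z * nrm A d \<le> nrm A z * (3/8)"
    using nrm_nonneg[of z] z(1) by (intro mult_left_mono) auto
  then show ?thesis
    using zd \<open>nrm A d \<le> 3/8\<close> by simp
qed

text \<open>For nonzero \<open>a\<close> the element \<open>a \<odot> w\<close> inverts e + x/a,
  which is the form in which Rickart's argument uses resolvents. The estimate comes from a w - b v =
  (a - b) w + b (w - v).\<close>

lemma resolvent_scaled_lipschitz:
  assumes x: "x \<in> corner" and w: "inv_pair (x \<oplus> a \<odot> e) w" and v: "inv_pair (x \<oplus> b \<odot> e) v"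
    and N: "nrm A w \<le> N" "nrm A v \<le> N"
  shows "nrm A (a \<odot> w \<ominus> b \<odot> v) \<le> cmod (a - b) * (N + cmod b * N\<^sup>2)"
proof -
  have c [simp]: "w \<in> carrier A" "v \<in> carrier A" using w v by auto
  have "a \<odot> w \<ominus> b \<odot> v = (a - b) \<odot> w \<oplus> b \<odot> (w \<ominus> v)"
    using sc_l_distr[of w a "- b"]
    by (simp add: sc_minus) (simp add: sc_neg M.minus_eq M.a_ac M.r_neg1 M.r_neg2 add_add_neg_cancel)
  then have "nrm A (a \<odot> w \<ominus> b \<odot> v) \<le> cmod (a - b) * nrm A w + cmod b * nrm A (w \<ominus> v)"
    using nrm_triangle[of "(a - b) \<odot> w" "b \<odot> (w \<ominus> v)"] by (simp add: nrm_smult)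
  also have "\<dots> \<le> cmod (a - b) * N + cmod b * (cmod (a - b) * N\<^sup>2)"
    using resolvent_lipschitz[OF assms] N by (intro add_mono mult_left_mono) auto
  finally show ?thesis by (simp add: algebra_simps)
qed

lemma resolvent_to_inverse:
  assumes x: "x \<in> corner" and w: "inv_pair (x \<oplus> (- r / c) \<odot> e) w" and "r \<noteq> 0" "c \<noteq> 0"
  shows "inv_pair (e \<ominus> c \<odot> ((1 / r) \<odot> x)) ((- r / c) \<odot> w)"
proof -
  have "(- c / r) \<odot> (x \<oplus> (- r / c) \<odot> e) = e \<ominus> c \<odot> ((1 / r) \<odot> x)"
    using x assms(3,4) sc_neg[of x "c / r"]
    by (simp add: sc_r_distr M.minus_eq M.a_ac)
  then show ?thesis
    using inv_pair_sc[OF w, of "- c / r"] x assms(3,4) by simp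
qed

text \<open>A quantitative Gelfand-Mazur theorem. The implication covers two outcomes at once: no
  inverse exists at \<open>c\<close>, or the inverse has norm above \<open>N\<close>.\<close>

theorem resolvent_unbounded:
  assumes x: "x \<in> corner"
  shows "\<exists>c\<in>test_scalars. \<forall>w. inv_pair (x \<oplus> c \<odot> e) w \<longrightarrow> nrm A w > N"
proof (rule ccontr)
  assume "\<not> ?thesis"
  then have "\<forall>c\<in>test_scalars. \<exists>w. inv_pair (x \<oplus> c \<odot> e) w \<and> nrm A w \<le> N"
    by (meson not_less)
  then obtain R where R: "\<And>c. c \<in> test_scalars \<Longrightarrow> inv_pair (x \<oplus> c \<odot> e) (R c)"
    and RN: "\<And>c. c \<in> test_scalars \<Longrightarrow> nrm A (R c) \<le> N"
    by metis
  have R0: "inv_pair x (R 0)"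
    using R[OF test_scalars_zero] x by simp
  then have N: "N > 0"
    using nrm_pos_if_inv_pair[of x "R 0"] RN[OF test_scalars_zero] x by simp
  define s where "s k = nrm A (iter_sq x k)" for k
  have s_nonneg: "0 \<le> s k" for k
    unfolding s_def using x by (intro nrm_nonneg) auto
  \<comment> \<open>The scalar 0 is a test scalar, so \<open>x\<close> has an inverse of norm at
    most \<open>N\<close>, whose iterated squares invert those of \<open>x\<close>. The resulting
    lower bound makes the spectral radius positive; otherwise there would be no room for a circle
    inside it.\<close>
  have s_lower: "1 \<le> s k * N ^ 2 ^ k" for k
  proof -
    let ?w = "iter_sq (R 0) k"
    have w: "R 0 \<in> corner" using R0 by simp
    have "inv_pair (iter_sq x k) ?w"
      using inv_pair_iter_sq[OF x R0] .
    then have "1 \<le> s k * nrm A ?w"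
      using nrm_mult[of "iter_sq x k" ?w] x w by (simp add: s_def inv_pair_def)
    also have "nrm A ?w \<le> N ^ 2 ^ k"
      using nrm_iter_sq_le[of "R 0" 0 N k] w RN[OF test_scalars_zero] by simp
    finally show ?thesis
      using s_nonneg[of k] by (meson mult_left_mono order_trans)
  qed
  \<comment> \<open>\<open>Inf T\<close> is the spectral radius of \<open>x\<close>: \<open>s k / r ^ 2 ^ k\<close> tends to 0 above it and is at least
      1 below it.\<close>
  define T where "T = {t. t > 0 \<and> (\<exists>k. s k < t ^ 2 ^ k)}"
  have T_lower: "1 / N \<le> t" if tT: "t \<in> T" for t
  proof (rule ccontr)
    assume "\<not> 1 / N \<le> t"
    then have "t * N < 1" using N by (simp add: field_simps)
    moreover obtain k where t: "t > 0" "s k < t ^ 2 ^ k"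
      using tT by (auto simp: T_def)
    ultimately have "(t * N) ^ 2 ^ k \<le> 1"
      using N by (intro power_le_one) auto
    moreover have "s k * N ^ 2 ^ k < t ^ 2 ^ k * N ^ 2 ^ k"
      using t N by (intro mult_strict_right_mono) auto
    ultimately show False
      using s_lower[of k] by (simp add: power_mult_distrib)
  qed
  have T_ne: "s 0 + 1 \<in> T"
    using s_nonneg[of 0] by (auto simp: T_def intro!: exI[of _ 0])
  have T_bdd: "bdd_below T"
    using T_lower by (auto simp: bdd_below_def)
  define \<nu> where "\<nu> = Inf T"
  have "1 / N \<le> \<nu>"
    unfolding \<nu>_def using T_ne T_lower by (intro cInf_greatest) auto
  then have \<nu>: "\<nu> > 0"
    using N by (meson less_le_trans zero_less_divide_1_iff)
  \<comment> \<open>\<open>K\<close> bounds the factor N + r' N^2 in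
    \<open>resolvent_scaled_lipschitz\<close> for radii r' below \<nu>. The radii will differ by at
    most 2 \<eta>, so the part 1/(16 K) of the minimum yields the distance 1/8 required by
    \<open>nrm_less_one_if_close_to_small\<close>; the part \<nu> keeps the inner radius
    positive.\<close>
  define K where "K = N + \<nu> * N\<^sup>2"
  have K: "K > 0" unfolding K_def using N \<nu> by (intro add_pos_nonneg) auto
  define \<eta> where "\<eta> = min \<nu> (1 / (16 * K))"
  have \<eta>: "\<eta> > 0" "\<eta> \<le> \<nu>" "2 * \<eta> * K \<le> 1/8"
    using \<nu> K by (auto simp: \<eta>_def min_def field_simps)
  obtain q' where q': "\<nu> - \<eta> < real_of_rat q'" "real_of_rat q' < \<nu>"
    using of_rat_dense[of "\<nu> - \<eta>" \<nu>] \<eta> by auto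
  obtain q where q: "\<nu> < real_of_rat q" "real_of_rat q < \<nu> + \<eta>"
    using of_rat_dense[of \<nu> "\<nu> + \<eta>"] \<eta> by auto
  define r where "r = real_of_rat q"
  define r' where "r' = real_of_rat q'"
  have r: "r > \<nu>" "r > 0" and r': "r' < \<nu>" "r' > 0" and rr: "\<bar>r - r'\<bar> \<le> 2 * \<eta>"
    using q q' \<eta> \<nu> unfolding r_def r'_def by linarith+
  have in_test: "- complex_of_real (real_of_rat u) / c \<in> test_scalars" if "c \<in> dyadic_roots" for u c
  proof -
    have "- complex_of_real (real_of_rat u) / c = (- inverse c) * of_real (real_of_rat u)"
      by (simp add: field_simps)
    then show ?thesis
      unfolding test_scalars_def using that dyadic_roots_neg dyadic_roots_inverse by blast
  qed
  define y where "y = (1 / complex_of_real r) \<odot> x"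
  define z where "z = (1 / complex_of_real r') \<odot> x"
  have yz [simp]: "y \<in> corner" "z \<in> corner" using x by (auto simp: y_def z_def)
  have base: "\<exists>w v. inv_pair (e \<ominus> c \<odot> y) w \<and> inv_pair (e \<ominus> c \<odot> z) v \<and> nrm A (w \<ominus> v) \<le> 1/8"
    if c: "c \<in> dyadic_roots" for c
  proof -
    have nc: "norm c = 1" "c \<noteq> 0" using dyadic_roots_norm[OF c] by auto
    let ?a = "- complex_of_real r / c" and ?b = "- complex_of_real r' / c"
    have ab: "?a \<in> test_scalars" "?b \<in> test_scalars"
      using in_test[OF c] by (auto simp: r_def r'_def)
    have "?a - ?b = - complex_of_real (r - r') / c"
      using nc by (simp add: field_simps)
    then have "cmod (?a - ?b) = \<bar>r - r'\<bar>" "cmod ?b = r'"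
      using nc r' by (auto simp: norm_divide simp del: of_real_diff)
    then have "nrm A (?a \<odot> R ?a \<ominus> ?b \<odot> R ?b) \<le> \<bar>r - r'\<bar> * (N + r' * N\<^sup>2)"
      using resolvent_scaled_lipschitz[OF x R R RN RN, OF ab ab] by simp
    also have "\<dots> \<le> (2 * \<eta>) * K"
      unfolding K_def using rr r' N \<eta> by (intro mult_mono add_mono) auto
    finally have "nrm A (?a \<odot> R ?a \<ominus> ?b \<odot> R ?b) \<le> 1/8"
      using \<eta> by simp
    moreover have "inv_pair (e \<ominus> c \<odot> y) (?a \<odot> R ?a)" "inv_pair (e \<ominus> c \<odot> z) (?b \<odot> R ?b)"
      unfolding y_def z_def using resolvent_to_inverse[OF x R] ab nc r r' by auto
    ultimately show ?thesis by blast
  qed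
  have nrm_y: "nrm A (iter_sq y k) = s k / r ^ 2 ^ k" and nrm_z: "nrm A (iter_sq z k) = s k / r' ^ 2 ^ k" for k
    unfolding y_def z_def s_def using x r r'
    by (simp_all add: iter_sq_sc nrm_smult norm_power norm_divide power_divide)
  have "r' \<notin> T"
    using cInf_lower[OF _ T_bdd, of r'] r' by (auto simp: \<nu>_def)
  then have z_ge: "1 \<le> nrm A (iter_sq z k)" for k
    using r' by (auto simp: nrm_z T_def not_less)
  obtain t where t: "t \<in> T" "t < r"
    using cInf_lessD[of T r] T_ne r by (auto simp: \<nu>_def)
  then obtain k\<^sub>0 where k0: "t > 0" "s k\<^sub>0 < t ^ 2 ^ k\<^sub>0" by (auto simp: T_def)
  \<comment> \<open>The crude estimate 2^k \<ge> k \<ge> n replaces the exponent 2^k by n, so k = k0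
    + n is large enough both for the certificate at k0 and for the bound 1/5.\<close>
  obtain n where n: "(t / r) ^ n < 1/5"
    using real_arch_pow_inv[of "1/5" "t / r"] t k0 r by auto
  define k where "k = k\<^sub>0 + n"
  have "nrm A (iter_sq y k) \<le> (t / r) ^ 2 ^ k"
    using nrm_iter_sq_le[OF x, of k\<^sub>0 t n] k0 r
    by (simp add: nrm_y s_def k_def power_divide divide_right_mono)
  also have "\<dots> \<le> (t / r) ^ n"
  proof (rule power_decreasing)
    have "n \<le> k" by (simp add: k_def)
    also have "k \<le> 2 ^ k" by (simp add: less_imp_le)
    finally show "n \<le> 2 ^ k" .
  qed (use t k0 r in auto)
  finally have small: "nrm A (iter_sq y k) \<le> 1/5" using n by simp
  \<comment> \<open>The other roots of unity serve only the induction in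
    \<open>inv_pair_iterate\<close>; its conclusion is wanted at c = 1.\<close>
  have one: "1 \<in> dyadic_roots" by (simp add: dyadic_roots_def)
  obtain w v where "inv_pair (e \<ominus> iter_sq y k) w" "inv_pair (e \<ominus> iter_sq z k) v"
      "nrm A (w \<ominus> v) \<le> 1/8"
    using inv_pair_iterate[OF yz base one, of k] by auto
  then have "nrm A (iter_sq z k) < 1"
    using nrm_less_one_if_close_to_small[of "iter_sq y k" w "iter_sq z k" v] small by simp
  then show False using z_ge[of k] by simp
qed

text \<open>Merges the two alternatives: if x + c e vanishes, \<open>e\<close> is a genuine
  eigenvector; otherwise (x + c e) w = e has norm 1, while \<open>w\<close> has norm at least
  \<open>K\<close>. Writing the quotient estimate as a product avoids any sign condition on
  \<open>K\<close>.\<close>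

lemma approx_eigenvector:
  assumes "x \<in> corner"
    and "x \<oplus> c \<odot> e = \<zero> \<or> (\<exists>w. inv_pair (x \<oplus> c \<odot> e) w \<and> K \<le> nrm A w)"
  shows "\<exists>w\<in>corner. nrm A w > 0 \<and> K * nrm A ((x \<oplus> c \<odot> e) \<otimes> w) \<le> nrm A w"
  using assms(2)
proof
  assume *: "x \<oplus> c \<odot> e = \<zero>"
  have "\<zero> \<otimes> e = \<zero>"
    using smult_mult_l[of e e 0] by simp
  then show ?thesis
    unfolding * by (intro bexI[of _ e]) auto
next
  assume "\<exists>w. inv_pair (x \<oplus> c \<odot> e) w \<and> K \<le> nrm A w"
  then obtain w where w: "inv_pair (x \<oplus> c \<odot> e) w" "K \<le> nrm A w" by blast
  then show ?thesis
    using nrm_pos_if_inv_pair[OF w(1)] assms(1) by (intro bexI[of _ w]) (auto simp: inv_pair_def)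
qed

text \<open>In c w = (x + c e) w - x w the first term is at most the norm of \<open>w\<close>,
  because K \<ge> 1. This bound yields convergent subsequences in each fibre and later places the
  limit in \<open>E\<close>.\<close>

lemma approx_spectrum_bounded:
  assumes x: "x \<in> corner" and K: "1 \<le> K"
    and "x \<oplus> c \<odot> e = \<zero> \<or> (\<exists>w. inv_pair (x \<oplus> c \<odot> e) w \<and> K \<le> nrm A w)"
  shows "cmod c \<le> nrm A x + 1"
proof -
  obtain w where w: "w \<in> corner" "nrm A w > 0" "K * nrm A ((x \<oplus> c \<odot> e) \<otimes> w) \<le> nrm A w"
    using approx_eigenvector[OF x assms(3)] by blast
  let ?y = "(x \<oplus> c \<odot> e) \<otimes> w"
  have y: "?y \<in> carrier A" using x w by simp
  have "c \<odot> w = ?y \<ominus> x \<otimes> w"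
    using x w by (simp add: distr_l smult_mult_l M.minus_eq M.a_ac M.r_neg1 M.r_neg2 add_add_neg_cancel)
  then have "cmod c * nrm A w \<le> nrm A ?y + nrm A (x \<otimes> w)"
    using nrm_minus_le[OF y, of "x \<otimes> w"] x w(1) nrm_smult[of w c] by simp
  also have "nrm A ?y \<le> K * nrm A ?y"
    using K nrm_nonneg[OF y] mult_right_mono[of 1 K "nrm A ?y"] by simp
  also have "\<dots> \<le> nrm A w" by (rule w)
  also have "nrm A (x \<otimes> w) \<le> nrm A x * nrm A w"
    using x w(1) by (intro nrm_mult) auto
  finally have "cmod c * nrm A w \<le> (nrm A x + 1) * nrm A w"
    by (simp add: algebra_simps)
  then show ?thesis using w(2) by simp
qed

text \<open>An inverse \<open>z\<close> at the limit would give w = z (x + a e) w for every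
  approximate eigenvector w. But (x + a e) w = (x + c_k e) w + (a - c_k) w has size at most 1/k + |a
  - c_k| relative to w, which tends to 0.\<close>

lemma not_invertible_at_limit:
  assumes x: "x \<in> corner" and lim: "c \<longlonglongrightarrow> a"
    and approx: "\<And>k::nat. x \<oplus> c k \<odot> e = \<zero> \<or>
      (\<exists>w. inv_pair (x \<oplus> c k \<odot> e) w \<and> real k \<le> nrm A w)"
  shows "\<not> inv_pair (x \<oplus> a \<odot> e) z"
proof
  assume z: "inv_pair (x \<oplus> a \<odot> e) z"
  have zc: "z \<in> corner" using z by simp
  have bound: "1 \<le> nrm A z * (1 / real k + cmod (a - c k))" if k: "k > 0" for k
  proof -
    obtain w where w: "w \<in> corner" "nrm A w > 0"
        "real k * nrm A ((x \<oplus> c k \<odot> e) \<otimes> w) \<le> nrm A w"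
      using approx_eigenvector[OF x approx[of k]] by blast
    let ?y = "(x \<oplus> c k \<odot> e) \<otimes> w"
    have y: "?y \<in> carrier A" using x w by simp
    have xa: "(x \<oplus> a \<odot> e) \<otimes> w = ?y \<oplus> (a - c k) \<odot> w"
      using x w sc_l_distr[of w "c k" "a - c k"]
      by (simp add: distr_l smult_mult_l M.a_assoc)
    have "w = (z \<otimes> (x \<oplus> a \<odot> e)) \<otimes> w"
      using z w by (simp add: inv_pair_def)
    also have "\<dots> = z \<otimes> (?y \<oplus> (a - c k) \<odot> w)"
      using x zc w(1) by (simp add: mult_assoc flip: xa)
    finally have "nrm A w \<le> nrm A z * nrm A (?y \<oplus> (a - c k) \<odot> w)"
      using nrm_mult[of z "?y \<oplus> (a - c k) \<odot> w"] y zc w(1) by simp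
    also have "nrm A (?y \<oplus> (a - c k) \<odot> w) \<le> nrm A w / real k + cmod (a - c k) * nrm A w"
    proof (rule order_trans[OF nrm_triangle])
      show "nrm A ?y + nrm A ((a - c k) \<odot> w) \<le> nrm A w / real k + cmod (a - c k) * nrm A w"
        using w(1,3) k by (simp add: nrm_smult pos_le_divide_eq mult.commute[of "real k"])
    qed (use y w in auto)
    finally have "nrm A w \<le> nrm A z * (nrm A w / real k + cmod (a - c k) * nrm A w)"
      using nrm_nonneg[of z] zc by (simp add: mult_left_mono)
    then have "nrm A w * 1 \<le> nrm A w * (nrm A z * (1 / real k + cmod (a - c k)))"
      by (simp add: algebra_simps)
    then show ?thesis using w(2) by (simp only: mult_le_cancel_left_pos)
  qed
  have "(\<lambda>k. nrm A z * (1 / real k + cmod (a - c k))) \<longlonglongrightarrow> nrm A z * (0 + cmod (a - a))"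
    by (intro tendsto_intros lim lim_1_over_n)
  then have "1 \<le> nrm A z * (0 + cmod (a - a))"
    by (rule tendsto_lowerbound)
      (auto intro!: bound eventually_mono[OF eventually_gt_at_top[of 0]])
  then show False by simp
qed

end

section \<open>Convergent subsequences with measurable indices\<close>

text \<open>The target is the lower limit, which is measurable, and the k-th index is the least n
  \<ge> k at which f is within 1/(k+1) of it. Taking the least index keeps the choice measurable.
  The indices need not increase with \<open>k\<close>; k \<le> \<open>m k x\<close> is enough to
  preserve limits.\<close>

lemma measurable_convergent_subsequence_real:
  fixes f :: "nat \<Rightarrow> 'a \<Rightarrow> real"
  assumes [measurable]: "\<And>n. f n \<in> borel_measurable M"
    and bound: "\<And>n x. x \<in> space M \<Longrightarrow> \<bar>f n x\<bar> \<le> G x"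
  obtains m :: "nat \<Rightarrow> 'a \<Rightarrow> nat"
  where "\<And>k. m k \<in> measurable M (count_space UNIV)"
    "\<And>k x. x \<in> space M \<Longrightarrow> k \<le> m k x"
    "\<And>x. x \<in> space M \<Longrightarrow> convergent (\<lambda>k. f (m k x) x)"
proof
  \<comment> \<open>In \<open>ereal\<close> the lower limit always exists. The bound
    \<open>G\<close> makes it finite on \<open>space M\<close>, so the conversion loses nothing
    there.\<close>
  define l where "l x = real_of_ereal (liminf (\<lambda>n. ereal (f n x)))" for x
  have l[measurable]: "l \<in> borel_measurable M" unfolding l_def by measurable
  have ex: "\<exists>n\<ge>k. \<bar>f n x - l x\<bar> < 1 / Suc k" if x: "x \<in> space M" for x k
  proof -
    let ?u = "\<lambda>n. ereal (f n x)"
    obtain r :: "nat \<Rightarrow> nat" where r: "strict_mono r" "(?u \<circ> r) \<longlonglongrightarrow> liminf ?u"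
      using liminf_subseq_lim[of ?u] by metis
    have "(?u \<circ> r) n \<in> {ereal (- G x)..ereal (G x)}" for n
      using bound[OF x, of "r n"] by (simp add: abs_le_iff)
    then have "liminf ?u \<in> {ereal (- G x)..ereal (G x)}"
      by (rule closed_sequentially[OF closed_atLeastAtMost _ r(2)])
    then have eq: "liminf ?u = ereal (l x)"
      unfolding l_def by (cases "liminf ?u") auto
    have "(\<lambda>n. f (r n) x) \<longlonglongrightarrow> l x"
      using r(2) unfolding eq by (simp add: comp_def)
    then have "\<forall>\<^sub>F n in sequentially. dist (f (r n) x) (l x) < 1 / Suc k"
      by (rule tendstoD) simp
    then have "\<forall>\<^sub>F n in sequentially. dist (f (r n) x) (l x) < 1 / Suc k \<and> k \<le> n"
      using eventually_ge_at_top by (rule eventually_conj)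
    then obtain n where "dist (f (r n) x) (l x) < 1 / Suc k" "k \<le> n"
      by (auto simp: eventually_sequentially)
    then show ?thesis
      using seq_suble[OF r(1), of n] by (intro exI[of _ "r n"]) (auto simp: dist_real_def)
  qed
  define m where "m k x = (LEAST n. k \<le> n \<and> \<bar>f n x - l x\<bar> < 1 / Suc k)" for k x
  show "m k \<in> measurable M (count_space UNIV)" for k
    unfolding m_def by measurable
  have m: "k \<le> m k x \<and> \<bar>f (m k x) x - l x\<bar> < 1 / Suc k" if "x \<in> space M" for k x
    unfolding m_def by (rule LeastI_ex) (use ex[OF that, of k] in blast)
  then show "k \<le> m k x" if "x \<in> space M" for k x using that by blast
  show "convergent (\<lambda>k. f (m k x) x)" if "x \<in> space M" for x
  proof (rule convergentI)
    have "(\<lambda>k. f (m k x) x - l x) \<longlonglongrightarrow> 0"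
      using m[OF that]
      by (intro tendsto_rabs_zero_cancel[OF tendsto_sandwich[OF _ _ tendsto_const LIMSEQ_inverse_real_of_nat]])
         (auto simp: inverse_eq_divide intro!: always_eventually less_imp_le)
    then show "(\<lambda>k. f (m k x) x) \<longlonglongrightarrow> l x"
      by (simp add: LIM_zero_iff)
  qed
qed

text \<open>The real case is applied twice: to the real parts, and then to the imaginary parts along
  the indices found first. The second choice does not disturb the limit of the real parts, because
  its indices also tend to infinity.\<close>

lemma measurable_convergent_subsequence_complex:
  fixes f :: "nat \<Rightarrow> 'a \<Rightarrow> complex"
  assumes f[measurable]: "\<And>n. f n \<in> borel_measurable M"
    and bound: "\<And>n x. x \<in> space M \<Longrightarrow> cmod (f n x) \<le> G x"
  obtains m :: "nat \<Rightarrow> 'a \<Rightarrow> nat"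
  where "\<And>k. m k \<in> measurable M (count_space UNIV)"
    "\<And>k x. x \<in> space M \<Longrightarrow> k \<le> m k x"
    "\<And>x. x \<in> space M \<Longrightarrow> convergent (\<lambda>k. f (m k x) x)"
proof -
  have Re_f: "(\<lambda>x. Re (f n x)) \<in> borel_measurable M" for n
    by measurable
  have Re_bd: "\<bar>Re (f n x)\<bar> \<le> G x" if "x \<in> space M" for n x
    using bound[OF that, of n] abs_Re_le_cmod[of "f n x"] by linarith
  obtain m where m[measurable]: "\<And>k. m k \<in> measurable M (count_space UNIV)"
    and mk: "\<And>k x. x \<in> space M \<Longrightarrow> k \<le> m k x"
    and mc: "\<And>x. x \<in> space M \<Longrightarrow> convergent (\<lambda>k. Re (f (m k x) x))"
    by (rule measurable_convergent_subsequence_real[of "\<lambda>n x. Re (f n x)" M G, OF Re_f Re_bd])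
       (assumption, rule that)
  define g where "g k x = f (m k x) x" for k x
  have g[measurable]: "g k \<in> borel_measurable M" for k
    unfolding g_def by (rule measurable_compose_countable[OF f m])
  have Im_g: "(\<lambda>x. Im (g n x)) \<in> borel_measurable M" for n
    by measurable
  have Im_bd: "\<bar>Im (g n x)\<bar> \<le> G x" if "x \<in> space M" for n x
    using bound[OF that, of "m n x"] abs_Im_le_cmod[of "g n x"] unfolding g_def by linarith
  obtain n where n[measurable]: "\<And>k. n k \<in> measurable M (count_space UNIV)"
    and nk: "\<And>k x. x \<in> space M \<Longrightarrow> k \<le> n k x"
    and nc: "\<And>x. x \<in> space M \<Longrightarrow> convergent (\<lambda>k. Im (g (n k x) x))"
    by (rule measurable_convergent_subsequence_real[of "\<lambda>n x. Im (g n x)" M G, OF Im_g Im_bd])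
       (assumption, rule that)
  show ?thesis
  proof (rule that[of "\<lambda>k x. m (n k x) x"])
    show "(\<lambda>x. m (n k x) x) \<in> measurable M (count_space UNIV)" for k
      by (rule measurable_compose_countable[OF m n])
    show "k \<le> m (n k x) x" if "x \<in> space M" for k x
      using mk[OF that, of "n k x"] nk[OF that, of k] by linarith
    show "convergent (\<lambda>k. f (m (n k x) x) x)" if x: "x \<in> space M" for x
    proof -
      obtain a where a: "(\<lambda>k. Re (f (m k x) x)) \<longlonglongrightarrow> a"
        using mc[OF x] by (auto simp: convergent_def)
      obtain b where b: "(\<lambda>k. Im (g (n k x) x)) \<longlonglongrightarrow> b"
        using nc[OF x] by (auto simp: convergent_def)
      have "filterlim (\<lambda>k. n k x) sequentially sequentially"
        by (rule filterlim_at_top_mono[OF filterlim_ident]) (use nk[OF x] in auto)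
      then have "(\<lambda>k. Re (f (m (n k x) x) x)) \<longlonglongrightarrow> a"
        using filterlim_compose[OF a] by blast
      then have "(\<lambda>k. Complex (Re (f (m (n k x) x) x)) (Im (f (m (n k x) x) x))) \<longlonglongrightarrow> Complex a b"
        using b by (intro tendsto_Complex) (simp_all add: g_def)
      then show ?thesis by (auto simp: convergent_def)
    qed
  qed
qed

section \<open>Measurable sections\<close>

lemma dom_sec_add [simp]: "dom (sec_add \<X> u v) = dom u \<inter> dom v"
  by (auto simp: sec_add_def split: if_splits)

lemma dom_sec_scale [simp]: "dom (sec_scale \<X> f u) = dom u"
  by (auto simp: sec_scale_def split: if_splits)

lemma the_sec_add: "\<omega> \<in> dom u \<inter> dom v \<Longrightarrow> the (sec_add \<X> u v \<omega>) = the (u \<omega>) \<oplus>\<^bsub>\<X> \<omega>\<^esub> the (v \<omega>)"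
  by (simp add: sec_add_def)

lemma the_sec_scale: "\<omega> \<in> dom u \<Longrightarrow> the (sec_scale \<X> f u \<omega>) = f \<omega> \<odot>\<^bsub>\<X> \<omega>\<^esub> the (u \<omega>)"
  by (simp add: sec_scale_def)

lemma the_sec_mult: "\<omega> \<in> dom u \<inter> dom v \<Longrightarrow> the (sec_mult \<X> u v \<omega>) = the (u \<omega>) \<otimes>\<^bsub>\<X> \<omega>\<^esub> the (v \<omega>)"
  by (simp add: sec_mult_def)

lemma (in banach_algebra) nrm_diff_le:
  assumes "x \<in> carrier A" "y \<in> carrier A"
  shows "\<bar>nrm A x - nrm A y\<bar> \<le> nrm A (x \<ominus> y)"
proof -
  have "x = (x \<ominus> y) \<oplus> y" "y = (y \<ominus> x) \<oplus> x"
    using assms by (simp_all add: M.minus_eq M.a_assoc M.l_neg)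
  then have "nrm A x \<le> nrm A (x \<ominus> y) + nrm A y" "nrm A y \<le> nrm A (y \<ominus> x) + nrm A x"
    using nrm_triangle[of "x \<ominus> y" y] nrm_triangle[of "y \<ominus> x" x] assms by auto
  moreover have "y \<ominus> x = \<ominus> (x \<ominus> y)"
    using assms by (simp add: M.minus_eq M.minus_add M.a_ac)
  then have "nrm A (y \<ominus> x) = nrm A (x \<ominus> y)"
    using assms by simp
  ultimately show ?thesis by linarith
qed

lemma (in banach_algebra) nrm_scale_diff_le:
  assumes "s \<in> carrier A" "u \<in> carrier A"
  shows "nrm A (a \<odot> s \<ominus> b \<odot> u) \<le> cmod a * nrm A (s \<ominus> u) + cmod (a - b) * nrm A u"
proof -
  have "a \<odot> s \<ominus> b \<odot> u = a \<odot> (s \<ominus> u) \<oplus> (a - b) \<odot> u"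
    using assms sc_l_distr[of u a "- b"]
    by (simp add: sc_minus) (simp add: sc_neg M.minus_eq M.a_assoc M.r_neg1)
  then show ?thesis
    using nrm_triangle[of "a \<odot> (s \<ominus> u)" "(a - b) \<odot> u"] assms by (simp add: nrm_smult)
qed

lemma (in banach_algebra) nrm_comb_diff_le:
  assumes "s \<in> carrier A" "u \<in> carrier A" "t \<in> carrier A" "v \<in> carrier A"
  shows "nrm A ((a \<odot> s \<oplus> c \<odot> t) \<ominus> (b \<odot> u \<oplus> d \<odot> v))
    \<le> (cmod a * nrm A (s \<ominus> u) + cmod (a - b) * nrm A u)
      + (cmod c * nrm A (t \<ominus> v) + cmod (c - d) * nrm A v)"
proof -
  have "(a \<odot> s \<oplus> c \<odot> t) \<ominus> (b \<odot> u \<oplus> d \<odot> v) = (a \<odot> s \<ominus> b \<odot> u) \<oplus> (c \<odot> t \<ominus> d \<odot> v)"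
    using assms by (simp add: M.minus_eq M.minus_add M.a_ac)
  then show ?thesis
    using nrm_triangle[of "a \<odot> s \<ominus> b \<odot> u" "c \<odot> t \<ominus> d \<odot> v"] assms
      nrm_scale_diff_le[of s u a b] nrm_scale_diff_le[of t v c d] by simp
qed

text \<open>Density of the values in the fibres allows an empty \<open>L\<close> only over an empty
  base. A member of \<open>L\<close> serves as default section, and as the source of the zero
  section, in the constructions with simple functions.\<close>

locale algebra_bundle =
  fixes M :: "'a measure" and \<X> :: "'a \<Rightarrow> 'b normed_alg" and L :: "('a \<rightharpoonup> 'b) set"
  assumes measurable_bundle: "measurable_bundle M \<X> L" and L_nonempty: "L \<noteq> {}"
begin

text \<open>A single operation covers the translates u + f e and, as f u + 0 u, the multiples f u,
  so closure of the measurable sections is proved once for both.\<close>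

definition comb :: "('a \<Rightarrow> complex) \<Rightarrow> ('a \<rightharpoonup> 'b) \<Rightarrow> ('a \<Rightarrow> complex) \<Rightarrow> ('a \<rightharpoonup> 'b) \<Rightarrow> ('a \<rightharpoonup> 'b)" where
  "comb f u g v = sec_add \<X> (sec_scale \<X> f u) (sec_scale \<X> g v)"

text \<open>
  Simple sections up to a.e. equality: simple functions with values in the set \<open>L\<close> of sections,
  evaluated along the diagonal.
\<close>

definition piecewise :: "('a \<rightharpoonup> 'b) \<Rightarrow> bool" where
  "piecewise s \<longleftrightarrow> (\<exists>K. simple_function M K \<and> (\<forall>\<omega>\<in>space M. K \<omega> \<in> L) \<and>
     (AE \<omega> in M. \<omega> \<in> dom (K \<omega>) \<and> s \<omega> = K \<omega> \<omega>))"

lemma fibre: "\<omega> \<in> space M \<Longrightarrow> banach_algebra (\<X> \<omega>)"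
  using measurable_bundle by (simp add: measurable_bundle_def)

lemma L_section: "c \<in> L \<Longrightarrow> is_section M \<X> c"
  using measurable_bundle by (simp add: measurable_bundle_def)

lemma L_comb: "\<lbrakk>c \<in> L; d \<in> L\<rbrakk> \<Longrightarrow> comb (\<lambda>_. k) c (\<lambda>_. l) d \<in> L"
  using measurable_bundle by (simp add: measurable_bundle_def comb_def)

lemma sectionD:
  assumes "is_section M \<X> u"
  shows "dom u \<subseteq> space M" "AE \<omega> in M. \<omega> \<in> dom u"
    "\<omega> \<in> dom u \<Longrightarrow> the (u \<omega>) \<in> carrier (\<X> \<omega>)"
  using assms by (auto simp: is_section_def)

lemma dom_comb [simp]: "dom (comb f u g v) = dom u \<inter> dom v"
  by (simp add: comb_def)

lemma the_comb:
  "\<omega> \<in> dom u \<inter> dom v \<Longrightarrow> the (comb f u g v \<omega>)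
     = f \<omega> \<odot>\<^bsub>\<X> \<omega>\<^esub> the (u \<omega>) \<oplus>\<^bsub>\<X> \<omega>\<^esub> g \<omega> \<odot>\<^bsub>\<X> \<omega>\<^esub> the (v \<omega>)"
  by (simp add: comb_def the_sec_add the_sec_scale)

lemma comb_cong: "\<lbrakk>f \<omega> = f' \<omega>; g \<omega> = g' \<omega>; u \<omega> = u' \<omega>; v \<omega> = v' \<omega>\<rbrakk>
    \<Longrightarrow> comb f u g v \<omega> = comb f' u' g' v' \<omega>"
  by (simp add: comb_def sec_add_def sec_scale_def dom_def)

lemma section_comb:
  assumes u: "is_section M \<X> u" and v: "is_section M \<X> v"
  shows "is_section M \<X> (comb f u g v)"
  unfolding is_section_def
proof (intro conjI ballI)
  show "dom (comb f u g v) \<subseteq> space M" using sectionD(1)[OF u] by auto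
  show "AE \<omega> in M. \<omega> \<in> dom (comb f u g v)"
    using sectionD(2)[OF u] sectionD(2)[OF v] by eventually_elim auto
  fix \<omega> assume \<omega>: "\<omega> \<in> dom (comb f u g v)"
  then interpret banach_algebra "\<X> \<omega>" using sectionD(1)[OF u] by (intro fibre) auto
  show "the (comb f u g v \<omega>) \<in> carrier (\<X> \<omega>)"
    using \<omega> sectionD(3)[OF u, of \<omega>] sectionD(3)[OF v, of \<omega>] by (simp add: the_comb)
qed

lemma simple_function_comb:
  assumes "simple_function M f" "simple_function M g" "simple_function M K" "simple_function M J"
  shows "simple_function M (\<lambda>\<omega>. comb (\<lambda>_. f \<omega>) (K \<omega>) (\<lambda>_. g \<omega>) (J \<omega>))"
proof -
  have "simple_function M (\<lambda>\<omega>. ((f \<omega>, K \<omega>), (g \<omega>, J \<omega>)))"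
    by (intro simple_function_Pair assms)
  from simple_function_compose1[OF this, of "\<lambda>((a, c), (b, d)). comb (\<lambda>_. a) c (\<lambda>_. b) d"]
  show ?thesis by simp
qed

lemma piecewise_comb:
  assumes "piecewise s" "piecewise t" and f: "simple_function M f" and g: "simple_function M g"
  shows "piecewise (comb f s g t)"
proof -
  obtain K where K: "simple_function M K" "\<And>\<omega>. \<omega> \<in> space M \<Longrightarrow> K \<omega> \<in> L"
      "AE \<omega> in M. \<omega> \<in> dom (K \<omega>) \<and> s \<omega> = K \<omega> \<omega>"
    using assms(1) by (auto simp: piecewise_def)
  obtain J where J: "simple_function M J" "\<And>\<omega>. \<omega> \<in> space M \<Longrightarrow> J \<omega> \<in> L"
      "AE \<omega> in M. \<omega> \<in> dom (J \<omega>) \<and> t \<omega> = J \<omega> \<omega>"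
    using assms(2) by (auto simp: piecewise_def)
  have "AE \<omega> in M. \<omega> \<in> dom (comb (\<lambda>_. f \<omega>) (K \<omega>) (\<lambda>_. g \<omega>) (J \<omega>))
      \<and> comb f s g t \<omega> = comb (\<lambda>_. f \<omega>) (K \<omega>) (\<lambda>_. g \<omega>) (J \<omega>) \<omega>"
    using K(3) J(3) by eventually_elim (auto intro!: comb_cong)
  then show ?thesis
    unfolding piecewise_def using simple_function_comb[OF f g K(1) J(1)] K(2) J(2) L_comb
    by blast
qed

text \<open>The sets in a simple section may overlap, so its \<open>L\<close>-valued function is
  built one summand at a time. At each point the new value is a combination with constant
  coefficients of members of \<open>L\<close>, hence again in \<open>L\<close>.\<close>

lemma piecewise_if_simple_section:
  assumes "simple_section M \<X> L s"
  shows "piecewise s"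
proof -
  obtain n A c where Ac: "\<And>i. i \<in> {1..n::nat} \<Longrightarrow> A i \<in> sets M" "\<And>i. i \<in> {1..n} \<Longrightarrow> c i \<in> L"
    and s: "s = (\<lambda>\<omega>. if \<forall>i\<in>{1..n}. \<omega> \<in> dom (c i)
            then Some (\<Oplus>\<^bsub>\<X> \<omega>\<^esub>i\<in>{1..n}. indicator (A i) \<omega> \<odot>\<^bsub>\<X> \<omega>\<^esub> the (c i \<omega>)) else None)"
    using assms unfolding simple_section_def by blast
  obtain c\<^sub>0 where c0: "c\<^sub>0 \<in> L" using L_nonempty by blast
  \<comment> \<open>The point must also lie in the domain of \<open>c\<^sub>0\<close>, since the
    empty sum is represented by 0 \<open>c\<^sub>0\<close> + 0 \<open>c\<^sub>0\<close>, a member of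
    \<open>L\<close> with that domain.\<close>
  have "\<exists>K. simple_function M K \<and> (\<forall>\<omega>\<in>space M. K \<omega> \<in> L) \<and>
      (\<forall>\<omega>\<in>space M. \<omega> \<in> dom c\<^sub>0 \<and> (\<forall>i\<in>{1..m}. \<omega> \<in> dom (c i)) \<longrightarrow> \<omega> \<in> dom (K \<omega>) \<and>
        the (K \<omega> \<omega>) = (\<Oplus>\<^bsub>\<X> \<omega>\<^esub>i\<in>{1..m}. indicator (A i) \<omega> \<odot>\<^bsub>\<X> \<omega>\<^esub> the (c i \<omega>)))"
    if "m \<le> n" for m
    using that
  proof (induction m)
    case 0
    have "the (comb (\<lambda>_. 0) c\<^sub>0 (\<lambda>_. 0) c\<^sub>0 \<omega>) = \<zero>\<^bsub>\<X> \<omega>\<^esub>" if "\<omega> \<in> space M" "\<omega> \<in> dom c\<^sub>0" for \<omega>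
    proof -
      interpret banach_algebra "\<X> \<omega>" using that by (intro fibre)
      show ?thesis
        using that sectionD(3)[OF L_section[OF c0], of \<omega>] by (simp add: the_comb)
    qed
    moreover have "(\<Oplus>\<^bsub>\<X> \<omega>\<^esub>i\<in>{}. indicator (A i) \<omega> \<odot>\<^bsub>\<X> \<omega>\<^esub> the (c i \<omega>)) = \<zero>\<^bsub>\<X> \<omega>\<^esub>"
      if "\<omega> \<in> space M" for \<omega>
    proof -
      interpret banach_algebra "\<X> \<omega>" using that by (intro fibre)
      show ?thesis by simp
    qed
    ultimately show ?case
      using L_comb[OF c0 c0, of 0 0]
      by (intro exI[of _ "\<lambda>_. comb (\<lambda>_. 0) c\<^sub>0 (\<lambda>_. 0) c\<^sub>0"]) auto
  next
    case (Suc m)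
    then obtain K where K: "simple_function M K" "\<And>\<omega>. \<omega> \<in> space M \<Longrightarrow> K \<omega> \<in> L"
      "\<And>\<omega>. \<omega> \<in> space M \<Longrightarrow> \<omega> \<in> dom c\<^sub>0 \<Longrightarrow> (\<And>i. i \<in> {1..m} \<Longrightarrow> \<omega> \<in> dom (c i)) \<Longrightarrow> \<omega> \<in> dom (K \<omega>) \<and>
        the (K \<omega> \<omega>) = (\<Oplus>\<^bsub>\<X> \<omega>\<^esub>i\<in>{1..m}. indicator (A i) \<omega> \<odot>\<^bsub>\<X> \<omega>\<^esub> the (c i \<omega>))"
      by auto
    have m: "Suc m \<in> {1..n}" "{1..Suc m} = insert (Suc m) {1..m}" using Suc.prems by auto
    define J where "J \<omega> = comb (\<lambda>_. indicator (A (Suc m)) \<omega>) (c (Suc m)) (\<lambda>_. 1) (K \<omega>)" for \<omega>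
    have "simple_function M J"
      unfolding J_def using Ac(1)[OF m(1)] K(1)
      by (intro simple_function_comb simple_function_indicator simple_function_const)
    moreover have "J \<omega> \<in> L" if "\<omega> \<in> space M" for \<omega>
      unfolding J_def using Ac(2)[OF m(1)] K(2)[OF that] by (rule L_comb)
    moreover have "\<omega> \<in> dom (J \<omega>) \<and>
        the (J \<omega> \<omega>) = (\<Oplus>\<^bsub>\<X> \<omega>\<^esub>i\<in>{1..Suc m}. indicator (A i) \<omega> \<odot>\<^bsub>\<X> \<omega>\<^esub> the (c i \<omega>))"
      if \<omega>: "\<omega> \<in> space M" "\<omega> \<in> dom c\<^sub>0" and d: "\<forall>i\<in>{1..Suc m}. \<omega> \<in> dom (c i)" for \<omega>
    proof -
      interpret banach_algebra "\<X> \<omega>" using \<omega> by (intro fibre)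
      have K\<omega>: "\<omega> \<in> dom (K \<omega>)"
        "the (K \<omega> \<omega>) = (\<Oplus>\<^bsub>\<X> \<omega>\<^esub>i\<in>{1..m}. indicator (A i) \<omega> \<odot>\<^bsub>\<X> \<omega>\<^esub> the (c i \<omega>))"
        using K(3)[OF \<omega>] d by auto
      have cl: "the (c i \<omega>) \<in> carrier (\<X> \<omega>)" if "i \<in> {1..Suc m}" for i
        using sectionD(3)[OF L_section[OF Ac(2)], of i \<omega>] d that Suc.prems by auto
      have cK: "the (K \<omega> \<omega>) \<in> carrier (\<X> \<omega>)"
        using sectionD(3)[OF L_section[OF K(2)], of \<omega> \<omega>] \<omega> K\<omega> by auto
      have "(\<Oplus>\<^bsub>\<X> \<omega>\<^esub>i\<in>insert (Suc m) {1..m}. indicator (A i) \<omega> \<odot>\<^bsub>\<X> \<omega>\<^esub> the (c i \<omega>))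
        = indicator (A (Suc m)) \<omega> \<odot>\<^bsub>\<X> \<omega>\<^esub> the (c (Suc m) \<omega>) \<oplus>\<^bsub>\<X> \<omega>\<^esub>
          (\<Oplus>\<^bsub>\<X> \<omega>\<^esub>i\<in>{1..m}. indicator (A i) \<omega> \<odot>\<^bsub>\<X> \<omega>\<^esub> the (c i \<omega>))"
        using cl by (intro M.finsum_insert) auto
      then show ?thesis
        unfolding m(2) J_def using K\<omega> cK d by (simp add: the_comb)
    qed
    ultimately show ?case by blast
  qed
  from this[of n] obtain K where K: "simple_function M K" "\<And>\<omega>. \<omega> \<in> space M \<Longrightarrow> K \<omega> \<in> L"
      "\<And>\<omega>. \<omega> \<in> space M \<Longrightarrow> \<omega> \<in> dom c\<^sub>0 \<Longrightarrow> (\<forall>i\<in>{1..n}. \<omega> \<in> dom (c i)) \<Longrightarrow> \<omega> \<in> dom (K \<omega>) \<and>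
        the (K \<omega> \<omega>) = (\<Oplus>\<^bsub>\<X> \<omega>\<^esub>i\<in>{1..n}. indicator (A i) \<omega> \<odot>\<^bsub>\<X> \<omega>\<^esub> the (c i \<omega>))"
    by auto
  have "AE \<omega> in M. \<forall>i\<in>{1..n}. \<omega> \<in> dom (c i)"
    using Ac(2) by (intro AE_finite_allI sectionD(2) L_section) auto
  moreover have "AE \<omega> in M. \<omega> \<in> dom c\<^sub>0" using sectionD(2)[OF L_section[OF c0]] .
  ultimately have "AE \<omega> in M. \<omega> \<in> dom (K \<omega>) \<and> s \<omega> = K \<omega> \<omega>"
    using AE_space
  proof eventually_elim
    case (elim \<omega>)
    then have "\<omega> \<in> dom (K \<omega>)" "the (K \<omega> \<omega>) = the (s \<omega>)" "\<omega> \<in> dom s"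
      using K(3)[of \<omega>] by (auto simp: s)
    then show ?case by (metis domD option.sel)
  qed
  then show ?thesis
    unfolding piecewise_def using K(1,2) by blast
qed

text \<open>The level sets of K are disjoint, so at each point exactly one summand survives. The sum
  is defined only where all occurring sections are, which costs a null set since they are finitely
  many.\<close>

lemma piecewise_imp_simple_section:
  assumes "piecewise s"
  shows "\<exists>s'. simple_section M \<X> L s' \<and> (AE \<omega> in M. \<omega> \<in> dom s' \<and> s' \<omega> = s \<omega>)"
proof -
  obtain K where K: "simple_function M K" "\<And>\<omega>. \<omega> \<in> space M \<Longrightarrow> K \<omega> \<in> L"
      "AE \<omega> in M. \<omega> \<in> dom (K \<omega>) \<and> s \<omega> = K \<omega> \<omega>"
    using assms(1) by (auto simp: piecewise_def)
  obtain c\<^sub>0 where c0: "c\<^sub>0 \<in> L" using L_nonempty by blast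
  \<comment> \<open>Including \<open>c\<^sub>0\<close> gives at least one summand, as
    \<open>simple_section\<close> demands, even over an empty space.\<close>
  define C where "C = insert c\<^sub>0 (K ` space M)"
  have C: "finite C" "C \<subseteq> L" using K c0 by (auto simp: C_def simple_functionD(1))
  obtain c where c: "bij_betw c {1..card C} C"
    using C(1) ex_bij_betw_nat_finite_1 by blast
  define A where "A i = K -` {c i} \<inter> space M" for i
  define s' where "s' = (\<lambda>\<omega>. if \<forall>i\<in>{1..card C}. \<omega> \<in> dom (c i)
     then Some (\<Oplus>\<^bsub>\<X> \<omega>\<^esub>i\<in>{1..card C}. indicator (A i) \<omega> \<odot>\<^bsub>\<X> \<omega>\<^esub> the (c i \<omega>)) else None)"
  have cL: "c i \<in> L" if "i \<in> {1..card C}" for i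
    using bij_betwE[OF c] that C(2) by blast
  have "card C \<ge> 1" using C(1) by (auto simp: C_def Suc_le_eq card_gt_0_iff)
  then have "simple_section M \<X> L s'"
    unfolding simple_section_def s'_def using simple_functionD(2)[OF K(1)] cL
    by (intro exI[of _ "card C"] exI[of _ A] exI[of _ c]) (auto simp: A_def)
  moreover have "AE \<omega> in M. \<forall>i\<in>{1..card C}. \<omega> \<in> dom (c i)"
    using cL by (intro AE_finite_allI sectionD(2) L_section) auto
  then have "AE \<omega> in M. \<omega> \<in> dom s' \<and> s' \<omega> = s \<omega>"
    using K(3) AE_space
  proof eventually_elim
    case (elim \<omega>)
    interpret banach_algebra "\<X> \<omega>" using elim by (intro fibre)
    have "K \<omega> \<in> C" using elim by (auto simp: C_def)
    then obtain j where j: "j \<in> {1..card C}" "c j = K \<omega>"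
      using bij_betw_imp_surj_on[OF c] by (metis imageE)
    have cl: "the (c i \<omega>) \<in> carrier (\<X> \<omega>)" if "i \<in> {1..card C}" for i
      using sectionD(3)[OF L_section[OF cL], of i \<omega>] elim that by auto
    have "indicator (A i) \<omega> \<odot>\<^bsub>\<X> \<omega>\<^esub> the (c i \<omega>) = (if j = i then the (c i \<omega>) else \<zero>\<^bsub>\<X> \<omega>\<^esub>)"
      if "i \<in> {1..card C}" for i
    proof (cases "j = i")
      case True
      then have "\<omega> \<in> A i" using j(2) elim by (simp add: A_def)
      then show ?thesis using True cl[OF that] by simp
    next
      case False
      then have "c i \<noteq> c j"
        using inj_onD[OF bij_betw_imp_inj_on[OF c], of i j] j(1) that by blast
      then have "\<omega> \<notin> A i" using j(2) by (simp add: A_def)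
      then show ?thesis using False cl[OF that] by simp
    qed
    then have "(\<Oplus>\<^bsub>\<X> \<omega>\<^esub>i\<in>{1..card C}. indicator (A i) \<omega> \<odot>\<^bsub>\<X> \<omega>\<^esub> the (c i \<omega>))
        = (\<Oplus>\<^bsub>\<X> \<omega>\<^esub>i\<in>{1..card C}. if j = i then the (c i \<omega>) else \<zero>\<^bsub>\<X> \<omega>\<^esub>)"
      using cl by (intro M.finsum_cong') auto
    also have "\<dots> = the (c j \<omega>)"
      using j cl by (intro M.finsum_singleton) auto
    finally show ?case
      using elim j by (auto simp: s'_def)
  qed
  ultimately show ?thesis by blast
qed

lemma piecewise_fibre:
  assumes "piecewise s"
  shows "AE \<omega> in M. \<omega> \<in> dom s \<and> the (s \<omega>) \<in> carrier (\<X> \<omega>)"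
proof -
  obtain K where K: "\<And>\<omega>. \<omega> \<in> space M \<Longrightarrow> K \<omega> \<in> L"
      "AE \<omega> in M. \<omega> \<in> dom (K \<omega>) \<and> s \<omega> = K \<omega> \<omega>"
    using assms by (auto simp: piecewise_def)
  from K(2) AE_space show ?thesis
  proof eventually_elim
    case (elim \<omega>)
    then show ?case
      using sectionD(3)[OF L_section[OF K(1)[of \<omega>]], of \<omega>] by (auto simp: dom_def)
  qed
qed

text \<open>The approximants may be changed on null sets, since countably many exceptional sets have
  a null union. In this form they can be combined by \<open>piecewise_comb\<close>.\<close>

lemma meas_sections_iff:
  "u \<in> meas_sections M \<X> L \<longleftrightarrow> is_section M \<X> u \<and> (\<exists>s. (\<forall>n::nat. piecewise (s n)) \<and>
     (AE \<omega> in M. (\<lambda>n. nrm (\<X> \<omega>) (the (s n \<omega>) \<ominus>\<^bsub>\<X> \<omega>\<^esub> the (u \<omega>))) \<longlonglongrightarrow> 0))"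
proof
  assume "u \<in> meas_sections M \<X> L"
  then show "is_section M \<X> u \<and> (\<exists>s. (\<forall>n::nat. piecewise (s n)) \<and>
     (AE \<omega> in M. (\<lambda>n. nrm (\<X> \<omega>) (the (s n \<omega>) \<ominus>\<^bsub>\<X> \<omega>\<^esub> the (u \<omega>))) \<longlonglongrightarrow> 0))"
    unfolding meas_sections_def
    by (fastforce intro: piecewise_if_simple_section elim: eventually_mono)
next
  assume *: "is_section M \<X> u \<and> (\<exists>s. (\<forall>n::nat. piecewise (s n)) \<and>
     (AE \<omega> in M. (\<lambda>n. nrm (\<X> \<omega>) (the (s n \<omega>) \<ominus>\<^bsub>\<X> \<omega>\<^esub> the (u \<omega>))) \<longlonglongrightarrow> 0))"
  then obtain s where s: "\<And>n::nat. piecewise (s n)"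
    and lim: "AE \<omega> in M. (\<lambda>n. nrm (\<X> \<omega>) (the (s n \<omega>) \<ominus>\<^bsub>\<X> \<omega>\<^esub> the (u \<omega>))) \<longlonglongrightarrow> 0"
    by blast
  obtain t where t: "\<And>n. simple_section M \<X> L (t n)"
    and ts: "\<And>n. AE \<omega> in M. \<omega> \<in> dom (t n) \<and> t n \<omega> = s n \<omega>"
    using piecewise_imp_simple_section[OF s] by metis
  have "AE \<omega> in M. \<forall>n. \<omega> \<in> dom (t n) \<and> t n \<omega> = s n \<omega>"
    using ts by (simp add: AE_all_countable)
  moreover have "AE \<omega> in M. \<omega> \<in> dom u"
    using * sectionD(2) by blast
  ultimately have "AE \<omega> in M. \<omega> \<in> dom u \<and> (\<forall>n. \<omega> \<in> dom (t n)) \<and>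
      (\<lambda>n. nrm (\<X> \<omega>) (the (t n \<omega>) \<ominus>\<^bsub>\<X> \<omega>\<^esub> the (u \<omega>))) \<longlonglongrightarrow> 0"
    using lim by eventually_elim simp
  then show "u \<in> meas_sections M \<X> L"
    unfolding meas_sections_def using * t by blast
qed

lemma meas_section: "u \<in> meas_sections M \<X> L \<Longrightarrow> is_section M \<X> u"
  by (simp add: meas_sections_iff)

text \<open>Since \<open>piecewise_comb\<close> admits only simple coefficients, \<open>f\<close>
  and \<open>g\<close> are approximated together with the two sections, and
  \<open>nrm_comb_diff_le\<close> controls all errors at once.\<close>

lemma meas_sections_comb:
  assumes u: "u \<in> meas_sections M \<X> L" and v: "v \<in> meas_sections M \<X> L"
    and f: "f \<in> borel_measurable M" and g: "g \<in> borel_measurable M"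
  shows "comb f u g v \<in> meas_sections M \<X> L"
proof -
  obtain s where s: "\<And>n::nat. piecewise (s n)"
    "AE \<omega> in M. (\<lambda>n. nrm (\<X> \<omega>) (the (s n \<omega>) \<ominus>\<^bsub>\<X> \<omega>\<^esub> the (u \<omega>))) \<longlonglongrightarrow> 0"
    using u by (auto simp: meas_sections_iff)
  obtain t where t: "\<And>n::nat. piecewise (t n)"
    "AE \<omega> in M. (\<lambda>n. nrm (\<X> \<omega>) (the (t n \<omega>) \<ominus>\<^bsub>\<X> \<omega>\<^esub> the (v \<omega>))) \<longlonglongrightarrow> 0"
    using v by (auto simp: meas_sections_iff)
  obtain F where F: "\<And>n::nat. simple_function M (F n)" "\<And>\<omega>. \<omega> \<in> space M \<Longrightarrow> (\<lambda>n. F n \<omega>) \<longlonglongrightarrow> f \<omega>"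
    using borel_measurable_implies_sequence_metric[OF f] by blast
  obtain G where G: "\<And>n::nat. simple_function M (G n)" "\<And>\<omega>. \<omega> \<in> space M \<Longrightarrow> (\<lambda>n. G n \<omega>) \<longlonglongrightarrow> g \<omega>"
    using borel_measurable_implies_sequence_metric[OF g] by blast
  have su: "is_section M \<X> u" "is_section M \<X> v" using u v meas_section by auto
  have "AE \<omega> in M. \<forall>n. \<omega> \<in> dom (s n) \<and> the (s n \<omega>) \<in> carrier (\<X> \<omega>)"
    using piecewise_fibre[OF s(1)] by (simp add: AE_all_countable)
  moreover have "AE \<omega> in M. \<forall>n. \<omega> \<in> dom (t n) \<and> the (t n \<omega>) \<in> carrier (\<X> \<omega>)"
    using piecewise_fibre[OF t(1)] by (simp add: AE_all_countable)
  ultimately have "AE \<omega> in M.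
      (\<lambda>n. nrm (\<X> \<omega>) (the (comb (F n) (s n) (G n) (t n) \<omega>) \<ominus>\<^bsub>\<X> \<omega>\<^esub> the (comb f u g v \<omega>))) \<longlonglongrightarrow> 0"
    using s(2) t(2) sectionD(2)[OF su(1)] sectionD(2)[OF su(2)] AE_space
  proof eventually_elim
    case (elim \<omega>)
    interpret banach_algebra "\<X> \<omega>" using elim by (intro fibre)
    have uv: "the (u \<omega>) \<in> carrier (\<X> \<omega>)" "the (v \<omega>) \<in> carrier (\<X> \<omega>)"
      using sectionD(3) su elim by blast+
    have st: "the (s n \<omega>) \<in> carrier (\<X> \<omega>)" "the (t n \<omega>) \<in> carrier (\<X> \<omega>)" for n
      using elim(1,2) by auto
    let ?d = "\<lambda>n. nrm (\<X> \<omega>) (the (comb (F n) (s n) (G n) (t n) \<omega>) \<ominus>\<^bsub>\<X> \<omega>\<^esub> the (comb f u g v \<omega>))"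
    let ?b = "\<lambda>n. (cmod (F n \<omega>) * nrm (\<X> \<omega>) (the (s n \<omega>) \<ominus>\<^bsub>\<X> \<omega>\<^esub> the (u \<omega>)) + cmod (F n \<omega> - f \<omega>) * nrm (\<X> \<omega>) (the (u \<omega>)))
      + (cmod (G n \<omega>) * nrm (\<X> \<omega>) (the (t n \<omega>) \<ominus>\<^bsub>\<X> \<omega>\<^esub> the (v \<omega>)) + cmod (G n \<omega> - g \<omega>) * nrm (\<X> \<omega>) (the (v \<omega>)))"
    have c1: "the (comb (F n) (s n) (G n) (t n) \<omega>)
        = F n \<omega> \<odot>\<^bsub>\<X> \<omega>\<^esub> the (s n \<omega>) \<oplus>\<^bsub>\<X> \<omega>\<^esub> G n \<omega> \<odot>\<^bsub>\<X> \<omega>\<^esub> the (t n \<omega>)" for n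
      using elim(1,2) by (intro the_comb) auto
    have c2: "the (comb f u g v \<omega>) = f \<omega> \<odot>\<^bsub>\<X> \<omega>\<^esub> the (u \<omega>) \<oplus>\<^bsub>\<X> \<omega>\<^esub> g \<omega> \<odot>\<^bsub>\<X> \<omega>\<^esub> the (v \<omega>)"
      using elim(5,6) by (intro the_comb) auto
    have le: "?d n \<le> ?b n" for n
      unfolding c1 c2 by (intro nrm_comb_diff_le st uv)
    have nn: "0 \<le> ?d n" for n
      unfolding c1 c2 using st uv by (intro nrm_nonneg) auto
    have "?b \<longlonglongrightarrow> (cmod (f \<omega>) * 0 + cmod (f \<omega> - f \<omega>) * nrm (\<X> \<omega>) (the (u \<omega>)))
      + (cmod (g \<omega>) * 0 + cmod (g \<omega> - g \<omega>) * nrm (\<X> \<omega>) (the (v \<omega>)))"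
      by (intro tendsto_intros F(2) G(2) elim)
    then have lim: "?b \<longlonglongrightarrow> 0" by simp
    show ?case
      by (rule tendsto_sandwich[OF _ _ tendsto_const lim]) (simp_all add: le nn)
  qed
  then show ?thesis
    unfolding meas_sections_iff using section_comb[OF su] piecewise_comb[OF s(1) t(1) F(1) G(1)]
    by (intro conjI exI[of _ "\<lambda>n. comb (F n) (s n) (G n) (t n)"]) auto
qed

lemma sec_scale_eq_comb:
  assumes "is_section M \<X> u"
  shows "sec_scale \<X> f u = comb f u (\<lambda>_. 0) u"
proof
  fix \<omega>
  show "sec_scale \<X> f u \<omega> = comb f u (\<lambda>_. 0) u \<omega>"
  proof (cases "\<omega> \<in> dom u")
    case True
    then interpret banach_algebra "\<X> \<omega>" using sectionD(1)[OF assms] by (intro fibre) auto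
    show ?thesis using True sectionD(3)[OF assms True] by (simp add: comb_def sec_add_def sec_scale_def dom_def)
  next
    case False
    then have "\<omega> \<notin> dom (sec_scale \<X> f u)" "\<omega> \<notin> dom (comb f u (\<lambda>_. 0) u)" by auto
    then show ?thesis by (metis domIff)
  qed
qed

lemma meas_sections_scale:
  "\<lbrakk>u \<in> meas_sections M \<X> L; f \<in> borel_measurable M\<rbrakk> \<Longrightarrow> sec_scale \<X> f u \<in> meas_sections M \<X> L"
  using meas_sections_comb[of u u f "\<lambda>_. 0"] by (simp add: sec_scale_eq_comb meas_section)

text \<open>The domain of \<open>c\<close> need not be a measurable set, but it contains the
  complement of a measurable null set. The norm is measurable on that complement and is extended by
  0.\<close>

lemma L_nrm:
  assumes c: "c \<in> L"
  shows "\<exists>g\<in>borel_measurable M. AE \<omega> in M. g \<omega> = sec_nrm \<X> c \<omega>"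
proof -
  obtain N where N: "\<And>\<omega>. \<omega> \<in> space M - N \<Longrightarrow> \<omega> \<in> dom c" "N \<in> null_sets M"
    using AE_E3[OF sectionD(2)[OF L_section[OF c]]] by blast
  have m: "sec_nrm \<X> c \<in> borel_measurable (restrict_space M (dom c))"
    using measurable_bundle c by (simp add: measurable_bundle_def)
  have "sec_nrm \<X> c \<in> borel_measurable (restrict_space M (space M - N))"
    using N(1) by (intro measurable_restrict_mono[OF m]) auto
  then have "(\<lambda>\<omega>. if \<omega> \<in> space M - N then sec_nrm \<X> c \<omega> else 0) \<in> borel_measurable M"
    using N(2) by (subst measurable_If_restrict_space_iff) (auto simp: set_diff_eq)
  moreover have "AE \<omega> in M. (if \<omega> \<in> space M - N then sec_nrm \<X> c \<omega> else 0) = sec_nrm \<X> c \<omega>"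
    using AE_not_in[OF N(2)] AE_space by eventually_elim simp
  ultimately show ?thesis by (intro bexI[of _ "\<lambda>\<omega>. if \<omega> \<in> space M - N then sec_nrm \<X> c \<omega> else 0"])
qed

text \<open>Only finitely many sections occur as values of K, so measurable versions of their norms
  can be glued along K.\<close>

lemma piecewise_nrm:
  assumes "piecewise s"
  shows "\<exists>g\<in>borel_measurable M. AE \<omega> in M. g \<omega> = sec_nrm \<X> s \<omega>"
proof -
  obtain K where K: "simple_function M K" "\<And>\<omega>. \<omega> \<in> space M \<Longrightarrow> K \<omega> \<in> L"
      "AE \<omega> in M. \<omega> \<in> dom (K \<omega>) \<and> s \<omega> = K \<omega> \<omega>"
    using assms by (auto simp: piecewise_def)
  obtain g where g: "\<And>c. c \<in> L \<Longrightarrow> g c \<in> borel_measurable M"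
    "\<And>c. c \<in> L \<Longrightarrow> AE \<omega> in M. g c \<omega> = sec_nrm \<X> c \<omega>"
    using L_nrm by metis
  have fin: "finite (K ` space M)" using K(1) by (rule simple_functionD)
  have gK: "(\<lambda>\<omega>. g c \<omega>) \<in> borel_measurable M" if "c \<in> K ` space M" for c
    using that K(2) by (auto intro: g(1))
  have Km: "K \<in> measurable M (count_space (K ` space M))"
    using K(1) by (intro measurable_count_space_eq2[OF fin, THEN iffD2]) (auto simp: simple_functionD(2))
  have "(\<lambda>\<omega>. g (K \<omega>) \<omega>) \<in> borel_measurable M"
    by (rule measurable_compose_countable'[OF gK Km countable_finite[OF fin]])
  moreover have "AE \<omega> in M. \<forall>c\<in>K ` space M. g c \<omega> = sec_nrm \<X> c \<omega>"
    using g(2) K(2) by (intro AE_finite_allI fin) auto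
  then have "AE \<omega> in M. g (K \<omega>) \<omega> = sec_nrm \<X> s \<omega>"
    using K(3) AE_space by eventually_elim (auto simp: sec_nrm_def)
  ultimately show ?thesis by (intro bexI[of _ "\<lambda>\<omega>. g (K \<omega>) \<omega>"])
qed

text \<open>By the reverse triangle inequality the norms of the approximants converge almost
  everywhere. The conclusion provides a representative because, over an incomplete measure, the norm
  itself may fail to be measurable.\<close>

lemma meas_sections_nrm:
  assumes u: "u \<in> meas_sections M \<X> L"
  obtains g where "g \<in> borel_measurable M" "AE \<omega> in M. g \<omega> = sec_nrm \<X> u \<omega>"
proof -
  obtain s where s: "\<And>n::nat. piecewise (s n)"
    "AE \<omega> in M. (\<lambda>n. nrm (\<X> \<omega>) (the (s n \<omega>) \<ominus>\<^bsub>\<X> \<omega>\<^esub> the (u \<omega>))) \<longlonglongrightarrow> 0"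
    using u by (auto simp: meas_sections_iff)
  obtain g where g: "\<And>n. g n \<in> borel_measurable M" "\<And>n. AE \<omega> in M. g n \<omega> = sec_nrm \<X> (s n) \<omega>"
    using piecewise_nrm[OF s(1)] by metis
  have "AE \<omega> in M. \<forall>n. \<omega> \<in> dom (s n) \<and> the (s n \<omega>) \<in> carrier (\<X> \<omega>)"
    using piecewise_fibre[OF s(1)] by (simp add: AE_all_countable)
  moreover have "AE \<omega> in M. \<forall>n. g n \<omega> = sec_nrm \<X> (s n) \<omega>"
    using g(2) by (simp add: AE_all_countable)
  ultimately have "AE \<omega> in M. lim (\<lambda>n. g n \<omega>) = sec_nrm \<X> u \<omega>"
    using s(2) sectionD(2)[OF meas_section[OF u]] AE_space
  proof eventually_elim
    case (elim \<omega>)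
    interpret banach_algebra "\<X> \<omega>" using elim by (intro fibre)
    have uc: "the (u \<omega>) \<in> carrier (\<X> \<omega>)"
      using sectionD(3)[OF meas_section[OF u]] elim by blast
    have "\<bar>g n \<omega> - sec_nrm \<X> u \<omega>\<bar> \<le> nrm (\<X> \<omega>) (the (s n \<omega>) \<ominus>\<^bsub>\<X> \<omega>\<^esub> the (u \<omega>))" for n
      using nrm_diff_le[of "the (s n \<omega>)" "the (u \<omega>)"] elim(1,2) uc by (simp add: sec_nrm_def)
    then have "(\<lambda>n. g n \<omega> - sec_nrm \<X> u \<omega>) \<longlonglongrightarrow> 0"
      by (intro tendsto_rabs_zero_cancel[OF tendsto_sandwich[OF _ _ tendsto_const elim(3)]]) auto
    then show ?case by (intro limI) (simp add: LIM_zero_iff)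
  qed
  moreover have "(\<lambda>\<omega>. lim (\<lambda>n. g n \<omega>)) \<in> borel_measurable M"
    using g(1) by measurable
  ultimately show ?thesis by (rule that[rotated])
qed

end

section \<open>Classes of functions and sections\<close>

text \<open>Operations on classes are unions over representatives; such a union collapses once all
  representatives agree and at least one exists.\<close>

lemma UN_const:
  assumes "\<And>u. u \<in> x \<Longrightarrow> F u = C" "x \<noteq> {}"
  shows "(\<Union>u\<in>x. F u) = C"
  using assms by auto

lemma UN_UN_const:
  assumes "\<And>u v. u \<in> x \<Longrightarrow> v \<in> y \<Longrightarrow> F u v = C" "x \<noteq> {}" "y \<noteq> {}"
  shows "(\<Union>u\<in>x. \<Union>v\<in>y. F u v) = C"
  using assms by auto

lemma fun_class_cong:
  assumes "AE \<omega> in M. f \<omega> = g \<omega>"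
  shows "fun_class M f = fun_class M g"
proof -
  have "(AE \<omega> in M. h \<omega> = f \<omega>) \<longleftrightarrow> (AE \<omega> in M. h \<omega> = g \<omega>)" for h
    using assms by (intro iffI) (erule (1) eventually_elim2, simp)+
  then show ?thesis by (simp add: fun_class_def)
qed

lemma fun_class_self: "f \<in> borel_measurable M \<Longrightarrow> f \<in> fun_class M f"
  by (simp add: fun_class_def)

lemma fun_classD: "h \<in> fun_class M f \<Longrightarrow> h \<in> borel_measurable M" "h \<in> fun_class M f \<Longrightarrow> AE \<omega> in M. h \<omega> = f \<omega>"
  by (auto simp: fun_class_def)

lemma fun_class_eqD:
  assumes "fun_class M f = fun_class M g" "f \<in> borel_measurable M"
  shows "AE \<omega> in M. f \<omega> = g \<omega>"
  using fun_class_self[OF assms(2)] fun_classD(2) assms(1) by blast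

lemma fun_class_in_L0: "f \<in> borel_measurable M \<Longrightarrow> fun_class M f \<in> L0 M"
  by (simp add: L0_def)

lemma L0_add_fun_class:
  assumes "f \<in> borel_measurable M" "g \<in> borel_measurable M"
  shows "L0_add M (fun_class M f) (fun_class M g) = fun_class M (\<lambda>\<omega>. f \<omega> + g \<omega>)"
  unfolding L0_add_def
proof (rule UN_UN_const)
  fix h k assume "h \<in> fun_class M f" "k \<in> fun_class M g"
  from this[THEN fun_classD(2)] show "fun_class M (\<lambda>\<omega>. h \<omega> + k \<omega>) = fun_class M (\<lambda>\<omega>. f \<omega> + g \<omega>)"
    by (intro fun_class_cong) (erule (1) eventually_elim2, simp)
qed (use fun_class_self[OF assms(1)] fun_class_self[OF assms(2)] in auto)

lemma L0_mult_fun_class: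
  assumes "f \<in> borel_measurable M" "g \<in> borel_measurable M"
  shows "L0_mult M (fun_class M f) (fun_class M g) = fun_class M (\<lambda>\<omega>. f \<omega> * g \<omega>)"
  unfolding L0_mult_def
proof (rule UN_UN_const)
  fix h k assume "h \<in> fun_class M f" "k \<in> fun_class M g"
  from this[THEN fun_classD(2)] show "fun_class M (\<lambda>\<omega>. h \<omega> * k \<omega>) = fun_class M (\<lambda>\<omega>. f \<omega> * g \<omega>)"
    by (intro fun_class_cong) (erule (1) eventually_elim2, simp)
qed (use fun_class_self[OF assms(1)] fun_class_self[OF assms(2)] in auto)

lemma L0_abs_fun_class:
  assumes "f \<in> borel_measurable M"
  shows "L0_abs M (fun_class M f) = fun_class M (\<lambda>\<omega>. complex_of_real (cmod (f \<omega>)))"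
proof -
  have *: "fun_class M (\<lambda>\<omega>. complex_of_real (cmod (h \<omega>))) = fun_class M (\<lambda>\<omega>. complex_of_real (cmod (f \<omega>)))"
    if "h \<in> fun_class M f" for h
    using fun_classD(2)[OF that] by (intro fun_class_cong) (erule eventually_mono, simp)
  show ?thesis
    unfolding L0_abs_def by (rule UN_const[OF *]) (use fun_class_self[OF assms] in auto)
qed

locale solid_algebra =
  fixes M :: "'a measure" and E
  assumes faithful_solid: "faithful_solid_subalgebra M E"
begin

lemma Linf_subset: "Linf M \<subseteq> E"
  and E_subset: "E \<subseteq> L0 M"
  and L0_add_in_E: "\<lbrakk>a \<in> E; b \<in> E\<rbrakk> \<Longrightarrow> L0_add M a b \<in> E"
  and L0_mult_in_E: "\<lbrakk>a \<in> E; b \<in> E\<rbrakk> \<Longrightarrow> L0_mult M a b \<in> E"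
  and abs_le_in_E: "\<lbrakk>a \<in> L0 M; b \<in> E; abs_le M a b\<rbrakk> \<Longrightarrow> a \<in> E"
  using faithful_solid unfolding faithful_solid_subalgebra_def by (simp_all, metis)

lemma E_rep:
  assumes "a \<in> E"
  obtains f where "f \<in> borel_measurable M" "a = fun_class M f"
  using assms subsetD[OF E_subset] unfolding L0_def by (metis imageE)

lemma E_solid:
  assumes f: "f \<in> borel_measurable M" and g: "fun_class M g \<in> E"
    and le: "AE \<omega> in M. cmod (f \<omega>) \<le> cmod (g \<omega>)"
  shows "fun_class M f \<in> E"
proof (rule abs_le_in_E[OF fun_class_in_L0[OF f] g])
  show "abs_le M (fun_class M f) (fun_class M g)"
    unfolding abs_le_def
  proof (intro ballI)
    fix h k assume "h \<in> fun_class M f" "k \<in> fun_class M g"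
    from this[THEN fun_classD(2)] le show "AE \<omega> in M. cmod (h \<omega>) \<le> cmod (k \<omega>)"
      by eventually_elim simp
  qed
qed

lemma E_bounded:
  assumes f: "f \<in> borel_measurable M" and "AE \<omega> in M. cmod (f \<omega>) \<le> C"
  shows "fun_class M f \<in> E"
  using assms(2) fun_class_in_L0[OF f] fun_class_self[OF f]
  by (intro subsetD[OF Linf_subset]) (auto simp: Linf_def)

lemma E_add:
  assumes "f \<in> borel_measurable M" "g \<in> borel_measurable M" "fun_class M f \<in> E" "fun_class M g \<in> E"
  shows "fun_class M (\<lambda>\<omega>. f \<omega> + g \<omega>) \<in> E"
  using L0_add_in_E[OF assms(3,4)] by (simp add: L0_add_fun_class assms(1,2))

lemma E_abs: "\<lbrakk>f \<in> borel_measurable M; fun_class M f \<in> E\<rbrakk> \<Longrightarrow> fun_class M (\<lambda>\<omega>. complex_of_real (cmod (f \<omega>))) \<in> E"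
  by (rule E_solid[of _ f]) auto

end

section \<open>Class operations computed on representatives\<close>

context algebra_bundle
begin

lemma sec_class_cong:
  assumes "AE \<omega> in M. u \<omega> = v \<omega>"
  shows "sec_class M \<X> L u = sec_class M \<X> L v"
proof -
  have "(AE \<omega> in M. w \<omega> = u \<omega>) \<longleftrightarrow> (AE \<omega> in M. w \<omega> = v \<omega>)" for w
    using assms by (intro iffI) (erule (1) eventually_elim2, simp)+
  then show ?thesis by (simp add: sec_class_def)
qed

lemma sec_class_self: "u \<in> meas_sections M \<X> L \<Longrightarrow> u \<in> sec_class M \<X> L u"
  by (simp add: sec_class_def)

lemma sec_classD:
  "v \<in> sec_class M \<X> L u \<Longrightarrow> v \<in> meas_sections M \<X> L"
  "v \<in> sec_class M \<X> L u \<Longrightarrow> AE \<omega> in M. v \<omega> = u \<omega>"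
  by (auto simp: sec_class_def)

lemma sec_class_in_L0_sec: "u \<in> meas_sections M \<X> L \<Longrightarrow> sec_class M \<X> L u \<in> L0_sec M \<X> L"
  by (simp add: L0_sec_def)

lemma L0_sec_rep:
  assumes "x \<in> L0_sec M \<X> L"
  obtains u where "u \<in> x"
  using assms sec_class_self by (auto simp: L0_sec_def)

lemma L0_secD:
  assumes "x \<in> L0_sec M \<X> L" "u \<in> x"
  shows "u \<in> meas_sections M \<X> L" "x = sec_class M \<X> L u"
proof -
  obtain w where "x = sec_class M \<X> L w" using assms(1) by (auto simp: L0_sec_def)
  then show "u \<in> meas_sections M \<X> L" "x = sec_class M \<X> L u"
    using assms(2) sec_classD[of u w] sec_class_cong[of u w] by simp_all
qed

lemma L0_sec_AE_eq:
  assumes "x \<in> L0_sec M \<X> L" "u \<in> x" "v \<in> x"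
  shows "AE \<omega> in M. v \<omega> = u \<omega>"
  using L0_secD(2)[OF assms(1,2)] assms(3) sec_classD(2) by blast

lemma class_add_eq:
  assumes x: "x \<in> L0_sec M \<X> L" "u \<in> x" and y: "y \<in> L0_sec M \<X> L" "v \<in> y"
  shows "class_add M \<X> L x y = sec_class M \<X> L (sec_add \<X> u v)"
  unfolding class_add_def
proof (rule UN_UN_const)
  fix u' v' assume "u' \<in> x" "v' \<in> y"
  then have "AE \<omega> in M. u' \<omega> = u \<omega>" "AE \<omega> in M. v' \<omega> = v \<omega>"
    by (simp_all add: L0_sec_AE_eq[OF x] L0_sec_AE_eq[OF y])
  then show "sec_class M \<X> L (sec_add \<X> u' v') = sec_class M \<X> L (sec_add \<X> u v)"
    by (intro sec_class_cong) (erule (1) eventually_elim2, simp add: sec_add_def dom_def)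
qed (use assms in auto)

lemma class_mult_eq:
  assumes x: "x \<in> L0_sec M \<X> L" "u \<in> x" and y: "y \<in> L0_sec M \<X> L" "v \<in> y"
  shows "class_mult M \<X> L x y = sec_class M \<X> L (sec_mult \<X> u v)"
  unfolding class_mult_def
proof (rule UN_UN_const)
  fix u' v' assume "u' \<in> x" "v' \<in> y"
  then have "AE \<omega> in M. u' \<omega> = u \<omega>" "AE \<omega> in M. v' \<omega> = v \<omega>"
    by (simp_all add: L0_sec_AE_eq[OF x] L0_sec_AE_eq[OF y])
  then show "sec_class M \<X> L (sec_mult \<X> u' v') = sec_class M \<X> L (sec_mult \<X> u v)"
    by (intro sec_class_cong) (erule (1) eventually_elim2, simp add: sec_mult_def dom_def)
qed (use assms in auto)

lemma class_mult_AE: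
  assumes x: "x \<in> L0_sec M \<X> L" "u \<in> x" and y: "y \<in> L0_sec M \<X> L" "v \<in> y"
    and w: "w \<in> class_mult M \<X> L x y"
  shows "AE \<omega> in M. the (w \<omega>) = the (u \<omega>) \<otimes>\<^bsub>\<X> \<omega>\<^esub> the (v \<omega>)"
proof -
  have "AE \<omega> in M. w \<omega> = sec_mult \<X> u v \<omega>"
    using w unfolding class_mult_eq[OF x y] by (rule sec_classD(2))
  moreover have "AE \<omega> in M. \<omega> \<in> dom u" "AE \<omega> in M. \<omega> \<in> dom v"
    using sectionD(2)[OF meas_section[OF L0_secD(1)[OF x]]] sectionD(2)[OF meas_section[OF L0_secD(1)[OF y]]]
    by auto
  ultimately show ?thesis
    by eventually_elim (simp add: the_sec_mult)
qed

lemma class_scale_eq: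
  assumes f: "f \<in> borel_measurable M" and x: "x \<in> L0_sec M \<X> L" "u \<in> x"
  shows "class_scale M \<X> L (fun_class M f) x = sec_class M \<X> L (sec_scale \<X> f u)"
  unfolding class_scale_def
proof (rule UN_UN_const)
  fix g v assume "g \<in> fun_class M f" "v \<in> x"
  then have "AE \<omega> in M. g \<omega> = f \<omega>" "AE \<omega> in M. v \<omega> = u \<omega>"
    by (simp_all add: L0_sec_AE_eq[OF x] fun_classD(2))
  then show "sec_class M \<X> L (sec_scale \<X> g v) = sec_class M \<X> L (sec_scale \<X> f u)"
    by (intro sec_class_cong) (erule (1) eventually_elim2, simp add: sec_scale_def dom_def)
qed (use x fun_class_self[OF f] in auto)

lemma class_nrm_eq:
  assumes x: "x \<in> L0_sec M \<X> L" "u \<in> x"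
  shows "class_nrm M \<X> x = fun_class M (\<lambda>\<omega>. complex_of_real (sec_nrm \<X> u \<omega>))"
proof -
  have *: "fun_class M (\<lambda>\<omega>. complex_of_real (sec_nrm \<X> v \<omega>)) = fun_class M (\<lambda>\<omega>. complex_of_real (sec_nrm \<X> u \<omega>))"
    if "v \<in> x" for v
    using L0_sec_AE_eq[OF x that] by (intro fun_class_cong) (erule eventually_mono, simp add: sec_nrm_def)
  show ?thesis
    unfolding class_nrm_def by (rule UN_const[OF *]) (use x(2) in auto)
qed

lemma class_support_eq_one:
  assumes u: "u \<in> meas_sections M \<X> L" and nz: "AE \<omega> in M. sec_nrm \<X> u \<omega> \<noteq> 0"
  shows "class_support M \<X> (sec_class M \<X> L u) = L0_one M"
proof -
  have eq: "class_nrm M \<X> (sec_class M \<X> L u) = fun_class M (\<lambda>\<omega>. complex_of_real (sec_nrm \<X> u \<omega>))"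
    by (rule class_nrm_eq[OF sec_class_in_L0_sec[OF u] sec_class_self[OF u]])
  \<comment> \<open>A measurable version of the norm is what makes the norm class nonempty; without
    it the union defining the support could be empty.\<close>
  obtain h where h: "h \<in> borel_measurable M" "AE \<omega> in M. h \<omega> = sec_nrm \<X> u \<omega>"
    using meas_sections_nrm[OF u] .
  have [measurable]: "h \<in> borel_measurable M" by (rule h(1))
  have "(\<lambda>\<omega>. complex_of_real (h \<omega>)) \<in> borel_measurable M" by measurable
  then have "(\<lambda>\<omega>. complex_of_real (h \<omega>)) \<in> fun_class M (\<lambda>\<omega>. complex_of_real (sec_nrm \<X> u \<omega>))"
    using h by (simp add: fun_class_def)
  moreover have "fun_class M (indicator {\<omega> \<in> space M. g \<omega> \<noteq> 0}) = L0_one M"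
    if "g \<in> fun_class M (\<lambda>\<omega>. complex_of_real (sec_nrm \<X> u \<omega>))" for g
  proof -
    have "AE \<omega> in M. indicator {\<omega> \<in> space M. g \<omega> \<noteq> 0} \<omega> = (1 :: complex)"
      using fun_classD(2)[OF that] nz AE_space by eventually_elim simp
    then show ?thesis
      unfolding L0_one_def by (rule fun_class_cong)
  qed
  ultimately show ?thesis
    unfolding class_support_def eq by (intro UN_const) auto
qed

end

section \<open>Sections as multiples of the unit\<close>

locale unital_bundle = algebra_bundle M \<X> L + solid_algebra M E
  for M :: "'a measure" and \<X> :: "'a \<Rightarrow> 'b normed_alg" and L E +
  fixes e
  assumes unit: "normalized_unit M E \<X> L e"
begin

definition e\<^sub>0 :: "'a \<rightharpoonup> 'b" where
  "e\<^sub>0 = (SOME u. u \<in> e)"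

abbreviation fibre_corner where
  "fibre_corner \<omega> \<equiv> pointed_banach_algebra.corner (\<X> \<omega>) (the (e\<^sub>0 \<omega>))"

abbreviation fibre_inv_pair where
  "fibre_inv_pair \<omega> \<equiv> pointed_banach_algebra.inv_pair (\<X> \<omega>) (the (e\<^sub>0 \<omega>))"

section \<open>The unit and inverses, fibre by fibre\<close>

lemma E_secD: "x \<in> E_sec M E \<X> L \<Longrightarrow> x \<in> L0_sec M \<X> L"
  by (simp add: E_sec_def)

lemma e_E_sec: "e \<in> E_sec M E \<X> L"
  using unit by (simp add: normalized_unit_def)

lemma e0: "e\<^sub>0 \<in> e"
  unfolding e\<^sub>0_def using L0_sec_rep[OF E_secD[OF e_E_sec]] by (metis someI)

lemma e0_meas: "e\<^sub>0 \<in> meas_sections M \<X> L" and e_eq: "e = sec_class M \<X> L e\<^sub>0"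
  using L0_secD[OF E_secD[OF e_E_sec] e0] by auto

lemma meas_fibre:
  assumes "u \<in> meas_sections M \<X> L"
  shows "AE \<omega> in M. \<omega> \<in> dom u \<and> the (u \<omega>) \<in> carrier (\<X> \<omega>)"
  using sectionD(2)[OF meas_section[OF assms]]
  by eventually_elim (use sectionD(3)[OF meas_section[OF assms]] in auto)

text \<open>The exceptional null set depends on \<open>u\<close>, so no statement about all elements
  of a fibre follows. Applied to \<open>e\<close> itself, this makes the value of
  \<open>e\<^sub>0\<close> an idempotent almost everywhere; for other sections it places their
  values in the corner of that idempotent.\<close>

lemma AE_unit:
  assumes x: "x \<in> E_sec M E \<X> L" "u \<in> x"
  shows "AE \<omega> in M. the (e\<^sub>0 \<omega>) \<otimes>\<^bsub>\<X> \<omega>\<^esub> the (u \<omega>) = the (u \<omega>)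
    \<and> the (u \<omega>) \<otimes>\<^bsub>\<X> \<omega>\<^esub> the (e\<^sub>0 \<omega>) = the (u \<omega>)"
proof -
  have "u \<in> class_mult M \<X> L e x" "u \<in> class_mult M \<X> L x e"
    using unit x by (simp_all add: normalized_unit_def)
  from class_mult_AE[OF E_secD[OF e_E_sec] e0 E_secD[OF x(1)] x(2) this(1)]
    class_mult_AE[OF E_secD[OF x(1)] x(2) E_secD[OF e_E_sec] e0 this(2)]
  show ?thesis by eventually_elim simp
qed

lemma AE_pointed: "AE \<omega> in M. pointed_banach_algebra (\<X> \<omega>) (the (e\<^sub>0 \<omega>))"
proof -
  have "fun_class M (\<lambda>_. 1) = fun_class M (\<lambda>\<omega>. complex_of_real (sec_nrm \<X> e\<^sub>0 \<omega>))"
    using unit class_nrm_eq[OF E_secD[OF e_E_sec] e0] by (simp add: normalized_unit_def L0_one_def)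
  then have "AE \<omega> in M. 1 = complex_of_real (sec_nrm \<X> e\<^sub>0 \<omega>)"
    by (rule fun_class_eqD) simp
  then show ?thesis
    using AE_unit[OF e_E_sec e0] meas_fibre[OF e0_meas] AE_space
  proof eventually_elim
    case (elim \<omega>)
    then show ?case
      using fibre[of \<omega>] by (simp add: pointed_banach_algebra_def pointed_banach_algebra_axioms_def sec_nrm_def)
  qed
qed

lemma AE_corner:
  assumes x: "x \<in> E_sec M E \<X> L" "u \<in> x"
  shows "AE \<omega> in M. the (u \<omega>) \<in> fibre_corner \<omega>"
  using AE_unit[OF x] AE_pointed meas_fibre[OF L0_secD(1)[OF E_secD[OF x(1)] x(2)]]
  by eventually_elim (simp add: pointed_banach_algebra.cornerI)

lemma E_secI:
  assumes u: "u \<in> meas_sections M \<X> L" and f: "fun_class M f \<in> E"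
    and le: "AE \<omega> in M. sec_nrm \<X> u \<omega> \<le> cmod (f \<omega>)"
  shows "sec_class M \<X> L u \<in> E_sec M E \<X> L"
proof -
  obtain h where h: "h \<in> borel_measurable M" "AE \<omega> in M. h \<omega> = sec_nrm \<X> u \<omega>"
    using meas_sections_nrm[OF u] .
  have [measurable]: "h \<in> borel_measurable M" by (rule h(1))
  have "AE \<omega> in M. cmod (complex_of_real (h \<omega>)) \<le> cmod (f \<omega>)"
    using h(2) le meas_fibre[OF u] AE_space
  proof eventually_elim
    case (elim \<omega>)
    then show ?case
      using banach_algebra.nrm_nonneg[OF fibre, of \<omega> "the (u \<omega>)"] by (simp add: sec_nrm_def)
  qed
  then have "fun_class M (\<lambda>\<omega>. complex_of_real (h \<omega>)) \<in> E"
    by (intro E_solid[OF _ f]) auto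
  moreover have "fun_class M (\<lambda>\<omega>. complex_of_real (h \<omega>)) = fun_class M (\<lambda>\<omega>. complex_of_real (sec_nrm \<X> u \<omega>))"
    using h(2) by (intro fun_class_cong) (erule eventually_mono, simp)
  ultimately show ?thesis
    unfolding E_sec_def using class_nrm_eq[OF sec_class_in_L0_sec[OF u] sec_class_self[OF u]]
      sec_class_in_L0_sec[OF u] by simp
qed

lemma E_sec_nrm:
  assumes x: "x \<in> E_sec M E \<X> L" "u \<in> x"
  obtains g where "g \<in> borel_measurable M" "AE \<omega> in M. g \<omega> = sec_nrm \<X> u \<omega>"
    "fun_class M (\<lambda>\<omega>. complex_of_real (g \<omega>)) \<in> E"
proof -
  obtain g where g: "g \<in> borel_measurable M" "AE \<omega> in M. g \<omega> = sec_nrm \<X> u \<omega>"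
    using meas_sections_nrm[OF L0_secD(1)[OF E_secD[OF x(1)] x(2)]] .
  have "fun_class M (\<lambda>\<omega>. complex_of_real (g \<omega>)) = class_nrm M \<X> x"
    unfolding class_nrm_eq[OF E_secD[OF x(1)] x(2)]
    using g(2) by (intro fun_class_cong) (erule eventually_mono, simp)
  then show ?thesis
    using x(1) by (intro that[OF g]) (simp add: E_sec_def)
qed

lemma sec_translate:
  assumes x: "x \<in> E_sec M E \<X> L" "u \<in> x"
    and f[measurable]: "f \<in> borel_measurable M" and fE: "fun_class M f \<in> E"
  defines "v \<equiv> comb (\<lambda>_. 1) u f e\<^sub>0"
  shows "v \<in> meas_sections M \<X> L" "sec_class M \<X> L v \<in> E_sec M E \<X> L"
    "AE \<omega> in M. the (v \<omega>) = the (u \<omega>) \<oplus>\<^bsub>\<X> \<omega>\<^esub> f \<omega> \<odot>\<^bsub>\<X> \<omega>\<^esub> the (e\<^sub>0 \<omega>)"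
proof -
  have u: "u \<in> meas_sections M \<X> L"
    using L0_secD(1)[OF E_secD[OF x(1)] x(2)] .
  show v: "v \<in> meas_sections M \<X> L"
    unfolding v_def using u e0_meas by (intro meas_sections_comb) auto
  show val: "AE \<omega> in M. the (v \<omega>) = the (u \<omega>) \<oplus>\<^bsub>\<X> \<omega>\<^esub> f \<omega> \<odot>\<^bsub>\<X> \<omega>\<^esub> the (e\<^sub>0 \<omega>)"
    using meas_fibre[OF u] meas_fibre[OF e0_meas] AE_pointed
  proof eventually_elim
    case (elim \<omega>)
    then interpret pointed_banach_algebra "\<X> \<omega>" "the (e\<^sub>0 \<omega>)" by blast
    show ?case using elim(1,2) by (simp add: v_def the_comb)
  qed
  obtain g where g[measurable]: "g \<in> borel_measurable M" and "AE \<omega> in M. g \<omega> = sec_nrm \<X> u \<omega>"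
    and gE: "fun_class M (\<lambda>\<omega>. complex_of_real (g \<omega>)) \<in> E"
    using E_sec_nrm[OF x] .
  have "fun_class M (\<lambda>\<omega>. complex_of_real (g \<omega>) + complex_of_real (cmod (f \<omega>))) \<in> E"
    using gE E_abs[OF f fE] by (intro E_add) auto
  then show "sec_class M \<X> L v \<in> E_sec M E \<X> L"
  proof (rule E_secI[OF v])
    show "AE \<omega> in M. sec_nrm \<X> v \<omega> \<le> cmod (complex_of_real (g \<omega>) + complex_of_real (cmod (f \<omega>)))"
      using \<open>AE \<omega> in M. g \<omega> = sec_nrm \<X> u \<omega>\<close> val meas_fibre[OF u] AE_pointed
    proof eventually_elim
      case (elim \<omega>)
      then interpret pointed_banach_algebra "\<X> \<omega>" "the (e\<^sub>0 \<omega>)" by blast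
      have "sec_nrm \<X> v \<omega> \<le> nrm (\<X> \<omega>) (the (u \<omega>)) + nrm (\<X> \<omega>) (f \<omega> \<odot>\<^bsub>\<X> \<omega>\<^esub> the (e\<^sub>0 \<omega>))"
        unfolding sec_nrm_def elim(2) using elim(3) by (intro nrm_triangle) auto
      also have "\<dots> = g \<omega> + cmod (f \<omega>)"
        using elim(1) by (simp add: nrm_smult sec_nrm_def)
      also have "\<dots> \<le> cmod (complex_of_real (g \<omega> + cmod (f \<omega>)))"
        unfolding norm_of_real by (rule abs_ge_self)
      finally show ?case by simp
    qed
  qed
qed

text \<open>
  Adding the unit on the zero set of \<open>u + f e\<close> gives a section of unit support, to which the
  hypothesis on inverses applies.
\<close>

lemma inverse_off_zero_set:
  assumes inv: "\<And>x. x \<in> E_sec M E \<X> L \<Longrightarrow> class_support M \<X> x = L0_one M \<Longrightarrow>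
           \<exists>y\<in>E_sec M E \<X> L. class_mult M \<X> L x y = e \<and> class_mult M \<X> L y x = e"
    and x: "x \<in> E_sec M E \<X> L" "u \<in> x"
    and f[measurable]: "f \<in> borel_measurable M" and fE: "fun_class M f \<in> E"
  obtains B z where "B \<in> sets M" "z \<in> meas_sections M \<X> L"
    "AE \<omega> in M. \<omega> \<in> B \<longrightarrow> the (u \<omega>) \<oplus>\<^bsub>\<X> \<omega>\<^esub> f \<omega> \<odot>\<^bsub>\<X> \<omega>\<^esub> the (e\<^sub>0 \<omega>) = \<zero>\<^bsub>\<X> \<omega>\<^esub>"
    "AE \<omega> in M. \<omega> \<notin> B \<longrightarrow> fibre_inv_pair \<omega> (the (u \<omega>) \<oplus>\<^bsub>\<X> \<omega>\<^esub> f \<omega> \<odot>\<^bsub>\<X> \<omega>\<^esub> the (e\<^sub>0 \<omega>)) (the (z \<omega>))"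
proof -
  define v where "v = comb (\<lambda>_. 1) u f e\<^sub>0"
  note v = sec_translate[OF x f fE, folded v_def]
  obtain g where g[measurable]: "g \<in> borel_measurable M" and gv: "AE \<omega> in M. g \<omega> = sec_nrm \<X> v \<omega>"
    using meas_sections_nrm[OF v(1)] .
  \<comment> \<open>The zero set is read off from the measurable version \<open>g\<close> of the
    norm; the exact zero set of \<open>v\<close> need not be measurable.\<close>
  define B where "B = {\<omega> \<in> space M. g \<omega> = 0}"
  have B[measurable]: "B \<in> sets M" unfolding B_def by measurable
  define f' where "f' \<omega> = f \<omega> + indicator B \<omega>" for \<omega>
  have f'[measurable]: "f' \<in> borel_measurable M" unfolding f'_def by measurable
  have "fun_class M (indicator B) \<in> E"
    by (rule E_bounded[of _ 1]) (auto simp: indicator_def)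
  then have f'E: "fun_class M f' \<in> E"
    unfolding f'_def using fE by (intro E_add) auto
  define w where "w = comb (\<lambda>_. 1) u f' e\<^sub>0"
  note w = sec_translate[OF x f' f'E, folded w_def]
  have u: "u \<in> meas_sections M \<X> L"
    using L0_secD(1)[OF E_secD[OF x(1)] x(2)] .
  have cases: "AE \<omega> in M. (\<omega> \<in> B \<longrightarrow> the (v \<omega>) = \<zero>\<^bsub>\<X> \<omega>\<^esub> \<and> the (w \<omega>) = the (e\<^sub>0 \<omega>))
      \<and> (\<omega> \<notin> B \<longrightarrow> the (w \<omega>) = the (v \<omega>) \<and> nrm (\<X> \<omega>) (the (v \<omega>)) \<noteq> 0)"
    using gv v(3) w(3) meas_fibre[OF u] AE_pointed AE_space
  proof eventually_elim
    case (elim \<omega>)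
    then interpret pointed_banach_algebra "\<X> \<omega>" "the (e\<^sub>0 \<omega>)" by blast
    have c: "the (u \<omega>) \<in> carrier (\<X> \<omega>)" "the (v \<omega>) \<in> carrier (\<X> \<omega>)"
      using elim(2,4) by auto
    show ?case
    proof (cases "\<omega> \<in> B")
      case True
      then have z: "the (v \<omega>) = \<zero>\<^bsub>\<X> \<omega>\<^esub>"
        using elim(1) nrm_eq_0_iff[OF c(2)] by (simp add: B_def sec_nrm_def)
      have "the (w \<omega>) = the (v \<omega>) \<oplus>\<^bsub>\<X> \<omega>\<^esub> the (e\<^sub>0 \<omega>)"
        unfolding elim(2,3) using True c(1) by (simp add: f'_def sc_l_distr M.a_assoc)
      then show ?thesis using True z by simp
    next
      case False
      then have "the (w \<omega>) = the (v \<omega>)"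
        unfolding elim(2,3) by (simp add: f'_def)
      then show ?thesis using False elim(1,6) by (simp add: B_def sec_nrm_def)
    qed
  qed
  have "AE \<omega> in M. sec_nrm \<X> w \<omega> \<noteq> 0"
    using cases AE_pointed
  proof eventually_elim
    case (elim \<omega>)
    then interpret pointed_banach_algebra "\<X> \<omega>" "the (e\<^sub>0 \<omega>)" by blast
    show ?case using elim(1) by (cases "\<omega> \<in> B") (auto simp: sec_nrm_def)
  qed
  then have "class_support M \<X> (sec_class M \<X> L w) = L0_one M"
    by (rule class_support_eq_one[OF w(1)])
  from inv[OF w(2) this] obtain y where y: "y \<in> E_sec M E \<X> L"
      "class_mult M \<X> L (sec_class M \<X> L w) y = e" "class_mult M \<X> L y (sec_class M \<X> L w) = e"
    by blast
  obtain z where z: "z \<in> y" using L0_sec_rep[OF E_secD[OF y(1)]] .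
  have wself: "w \<in> sec_class M \<X> L w" using sec_class_self[OF w(1)] .
  have 1: "AE \<omega> in M. the (e\<^sub>0 \<omega>) = the (w \<omega>) \<otimes>\<^bsub>\<X> \<omega>\<^esub> the (z \<omega>)"
    using e0 y(2) by (intro class_mult_AE[OF E_secD[OF w(2)] wself E_secD[OF y(1)] z]) simp
  have 2: "AE \<omega> in M. the (e\<^sub>0 \<omega>) = the (z \<omega>) \<otimes>\<^bsub>\<X> \<omega>\<^esub> the (w \<omega>)"
    using e0 y(3) by (intro class_mult_AE[OF E_secD[OF y(1)] z E_secD[OF w(2)] wself]) simp
  show ?thesis
  proof (rule that[OF B, of z])
    show "z \<in> meas_sections M \<X> L" using L0_secD(1)[OF E_secD[OF y(1)] z] .
    show "AE \<omega> in M. \<omega> \<in> B \<longrightarrow> the (u \<omega>) \<oplus>\<^bsub>\<X> \<omega>\<^esub> f \<omega> \<odot>\<^bsub>\<X> \<omega>\<^esub> the (e\<^sub>0 \<omega>) = \<zero>\<^bsub>\<X> \<omega>\<^esub>"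
      using cases v(3) by eventually_elim simp
    show "AE \<omega> in M. \<omega> \<notin> B \<longrightarrow> fibre_inv_pair \<omega> (the (u \<omega>) \<oplus>\<^bsub>\<X> \<omega>\<^esub> f \<omega> \<odot>\<^bsub>\<X> \<omega>\<^esub> the (e\<^sub>0 \<omega>)) (the (z \<omega>))"
      using cases v(3) 1 2 AE_corner[OF y(1) z] AE_pointed
    proof eventually_elim
      case (elim \<omega>)
      then interpret pointed_banach_algebra "\<X> \<omega>" "the (e\<^sub>0 \<omega>)" by blast
      show ?case
      proof
        assume "\<omega> \<notin> B"
        then have wv: "the (u \<omega>) \<oplus>\<^bsub>\<X> \<omega>\<^esub> f \<omega> \<odot>\<^bsub>\<X> \<omega>\<^esub> the (e\<^sub>0 \<omega>) = the (w \<omega>)"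
          using elim(1,2) by simp
        show "inv_pair (the (u \<omega>) \<oplus>\<^bsub>\<X> \<omega>\<^esub> f \<omega> \<odot>\<^bsub>\<X> \<omega>\<^esub> the (e\<^sub>0 \<omega>)) (the (z \<omega>))"
          unfolding wv inv_pair_def using elim(3)[symmetric] elim(4)[symmetric] elim(5) by blast
      qed
    qed
  qed
qed

text \<open>The hypothesis on inverses enters at the countably many constants \<open>c j\<close>,
  which determine \<open>a\<close>, and then at \<open>a\<close>. The null set of the last use
  depends on \<open>a\<close>, so the candidate has to be fixed before it is tested.\<close>

lemma scalar_multiple_of_unit:
  assumes inv: "\<And>x. x \<in> E_sec M E \<X> L \<Longrightarrow> class_support M \<X> x = L0_one M \<Longrightarrow>
           \<exists>y\<in>E_sec M E \<X> L. class_mult M \<X> L x y = e \<and> class_mult M \<X> L y x = e"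
    and x: "x \<in> E_sec M E \<X> L" "u \<in> x"
  obtains a where "a \<in> borel_measurable M" "fun_class M a \<in> E"
    "AE \<omega> in M. the (u \<omega>) = a \<omega> \<odot>\<^bsub>\<X> \<omega>\<^esub> the (e\<^sub>0 \<omega>)"
proof -
  define c where "c = from_nat_into test_scalars"
  have c_range: "range c = test_scalars"
    unfolding c_def using test_scalars_zero countable_test_scalars by (intro range_from_nat_into) auto
  let ?v = "\<lambda>\<omega> a. the (u \<omega>) \<oplus>\<^bsub>\<X> \<omega>\<^esub> a \<odot>\<^bsub>\<X> \<omega>\<^esub> the (e\<^sub>0 \<omega>)"
  have const_E: "fun_class M (\<lambda>_. k) \<in> E" for k
    by (rule E_bounded[of _ "cmod k"]) auto
  define Q where "Q f B z \<longleftrightarrow> B \<in> sets M \<and> z \<in> meas_sections M \<X> L \<and>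
      (AE \<omega> in M. \<omega> \<in> B \<longrightarrow> ?v \<omega> (f \<omega>) = \<zero>\<^bsub>\<X> \<omega>\<^esub>) \<and>
      (AE \<omega> in M. \<omega> \<notin> B \<longrightarrow> fibre_inv_pair \<omega> (?v \<omega> (f \<omega>)) (the (z \<omega>)))" for f B z
  have Q_ex: "\<exists>B z. Q f B z" if "f \<in> borel_measurable M" "fun_class M f \<in> E" for f
    by (rule inverse_off_zero_set[OF inv x that])
      (assumption+, unfold Q_def, intro exI conjI)
  have "\<exists>B z. Q (\<lambda>_. c j) B z" for j
    by (rule Q_ex[OF borel_measurable_const const_E])
  then obtain B z where Q: "\<And>j. Q (\<lambda>_. c j) (B j) (z j)"
    by metis
  then have B[measurable]: "B j \<in> sets M" and z: "z j \<in> meas_sections M \<X> L"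
    and Bz: "AE \<omega> in M. \<omega> \<in> B j \<longrightarrow> ?v \<omega> (c j) = \<zero>\<^bsub>\<X> \<omega>\<^esub>"
      "AE \<omega> in M. \<omega> \<notin> B j \<longrightarrow> fibre_inv_pair \<omega> (?v \<omega> (c j)) (the (z j \<omega>))" for j
    using Q[of j] unfolding Q_def by blast+
  have "\<exists>h. h \<in> borel_measurable M \<and> (AE \<omega> in M. h \<omega> = sec_nrm \<X> (z j) \<omega>)" for j
    using meas_sections_nrm[OF z] by metis
  then obtain h where h[measurable]: "\<And>j. h j \<in> borel_measurable M"
    and hz: "\<And>j. AE \<omega> in M. h j \<omega> = sec_nrm \<X> (z j) \<omega>"
    by metis
  have "AE \<omega> in M. \<forall>j. (\<omega> \<in> B j \<longrightarrow> ?v \<omega> (c j) = \<zero>\<^bsub>\<X> \<omega>\<^esub>)"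
    and "AE \<omega> in M. \<forall>j. (\<omega> \<notin> B j \<longrightarrow> fibre_inv_pair \<omega> (?v \<omega> (c j)) (the (z j \<omega>)))"
    and "AE \<omega> in M. \<forall>j. h j \<omega> = sec_nrm \<X> (z j) \<omega>"
    unfolding AE_all_countable using Bz hz by auto
  with AE_pointed AE_corner[OF x]
  have "AE \<omega> in M. pointed_banach_algebra (\<X> \<omega>) (the (e\<^sub>0 \<omega>)) \<and> the (u \<omega>) \<in> fibre_corner \<omega> \<and>
     (\<forall>j. \<omega> \<in> B j \<longrightarrow> ?v \<omega> (c j) = \<zero>\<^bsub>\<X> \<omega>\<^esub>) \<and>
     (\<forall>j. \<omega> \<notin> B j \<longrightarrow> fibre_inv_pair \<omega> (?v \<omega> (c j)) (the (z j \<omega>)) \<and> h j \<omega> = sec_nrm \<X> (z j) \<omega>)"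
    (is "AE \<omega> in M. ?good \<omega>")
    by eventually_elim simp
  \<comment> \<open>From here on all countably many almost-everywhere statements hold pointwise
    outside one measurable null set, and the scalars can be chosen point by point.\<close>
  then obtain N where "\<And>\<omega>. \<omega> \<in> space M - N \<Longrightarrow> ?good \<omega>" and N[measurable]: "N \<in> null_sets M"
    by (rule AE_E3) (rule that)
  then have good: "pointed_banach_algebra (\<X> \<omega>) (the (e\<^sub>0 \<omega>))" "the (u \<omega>) \<in> fibre_corner \<omega>"
      "\<And>j. \<omega> \<in> B j \<Longrightarrow> ?v \<omega> (c j) = \<zero>\<^bsub>\<X> \<omega>\<^esub>"
      "\<And>j. \<omega> \<notin> B j \<Longrightarrow> fibre_inv_pair \<omega> (?v \<omega> (c j)) (the (z j \<omega>)) \<and> h j \<omega> = sec_nrm \<X> (z j) \<omega>"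
    if "\<omega> \<in> space M - N" for \<omega>
    using that by simp_all
  have [measurable]: "N \<in> sets M" using N by auto
  \<comment> \<open>\<open>P k j \<omega>\<close>: the resolvent of \<open>u \<omega>\<close> at \<open>- c j\<close> is undefined or has norm at least \<open>k + 1\<close>\<close>
  define P where "P k j \<omega> \<longleftrightarrow> \<omega> \<in> B j \<or> real (Suc k) \<le> h j \<omega>" for k j \<omega>
  have P_ex: "\<exists>j. P k j \<omega>" if \<omega>: "\<omega> \<in> space M - N" for k \<omega>
  proof -
    interpret pointed_banach_algebra "\<X> \<omega>" "the (e\<^sub>0 \<omega>)" using good(1)[OF \<omega>] .
    obtain a where "a \<in> test_scalars" and a: "\<And>w. inv_pair (?v \<omega> a) w \<Longrightarrow> real (Suc k) < nrm (\<X> \<omega>) w"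
      using resolvent_unbounded[OF good(2)[OF \<omega>], of "real (Suc k)"] by blast
    then obtain j where j: "a = c j" using c_range by blast
    have "P k j \<omega>"
    proof (cases "\<omega> \<in> B j")
      case False
      then show ?thesis
        using good(4)[OF \<omega> False] a[of "the (z j \<omega>)"] by (simp add: P_def sec_nrm_def j)
    qed (simp add: P_def)
    then show ?thesis ..
  qed
  \<comment> \<open>On \<open>N\<close> there may be no index satisfying \<open>P k\<close>, so the
    value is set to 0. This keeps \<open>d\<close> measurable and bounded at every point, as the
    subsequence lemma requires.\<close>
  define d where "d k \<omega> = (if \<omega> \<in> N then 0 else c (LEAST j. P k j \<omega>))" for k \<omega>
  have d[measurable]: "d k \<in> borel_measurable M" for k
  proof -
    have [measurable]: "(\<lambda>\<omega>. LEAST j. P k j \<omega>) \<in> measurable M (count_space UNIV)"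
      unfolding P_def by measurable
    have [measurable]: "c \<in> measurable (count_space UNIV) borel" by simp
    show ?thesis unfolding d_def by measurable
  qed
  have approx: "?v \<omega> (d k \<omega>) = \<zero>\<^bsub>\<X> \<omega>\<^esub> \<or>
      (\<exists>w. fibre_inv_pair \<omega> (?v \<omega> (d k \<omega>)) w \<and> real (Suc k) \<le> nrm (\<X> \<omega>) w)"
    if \<omega>: "\<omega> \<in> space M - N" for k \<omega>
  proof -
    define j where "j = (LEAST j. P k j \<omega>)"
    have "P k j \<omega>" unfolding j_def using P_ex[OF \<omega>] by (rule LeastI_ex)
    moreover have "d k \<omega> = c j" using \<omega> by (simp add: d_def j_def)
    ultimately show ?thesis
      using good(3,4)[OF \<omega>, of j] unfolding P_def sec_nrm_def by (metis (no_types, lifting))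
  qed
  define G where "G \<omega> = (if \<omega> \<in> N then 0 else sec_nrm \<X> u \<omega> + 1)" for \<omega>
  have d_le: "cmod (d k \<omega>) \<le> G \<omega>" if "\<omega> \<in> space M" for k \<omega>
  proof (cases "\<omega> \<in> N")
    case False
    then have \<omega>: "\<omega> \<in> space M - N" using that by blast
    interpret pointed_banach_algebra "\<X> \<omega>" "the (e\<^sub>0 \<omega>)" using good(1)[OF \<omega>] .
    show ?thesis
      using approx_spectrum_bounded[OF good(2)[OF \<omega>] _ approx[OF \<omega>, of k]] False
      by (simp add: G_def sec_nrm_def)
  qed (simp add: d_def G_def)
  obtain m where m[measurable]: "\<And>k. m k \<in> measurable M (count_space UNIV)"
    and mk: "\<And>k \<omega>. \<omega> \<in> space M \<Longrightarrow> k \<le> m k \<omega>"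
    and conv: "\<And>\<omega>. \<omega> \<in> space M \<Longrightarrow> convergent (\<lambda>k. d (m k \<omega>) \<omega>)"
    by (rule measurable_convergent_subsequence_complex[of d M G, OF d d_le]) (assumption, rule that)
  have dm[measurable]: "(\<lambda>\<omega>. d (m k \<omega>) \<omega>) \<in> borel_measurable M" for k
    by (rule measurable_compose_countable[OF d m])
  define a where "a \<omega> = lim (\<lambda>k. d (m k \<omega>) \<omega>)" for \<omega>
  have a[measurable]: "a \<in> borel_measurable M" unfolding a_def by measurable
  have lim: "(\<lambda>k. d (m k \<omega>) \<omega>) \<longlonglongrightarrow> a \<omega>" if "\<omega> \<in> space M" for \<omega>
    unfolding a_def using conv[OF that] by (simp add: convergent_LIMSEQ_iff)
  have a_le: "cmod (a \<omega>) \<le> G \<omega>" if "\<omega> \<in> space M" for \<omega>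
    using d_le[OF that] by (intro tendsto_upperbound[OF tendsto_norm[OF lim[OF that]]]) auto
  have aE: "fun_class M a \<in> E"
  proof -
    \<comment> \<open>\<open>G\<close> need not be measurable, so solidity of \<open>E\<close> is
      applied with g + 1, which agrees with \<open>G\<close> almost everywhere.\<close>
    obtain g where g[measurable]: "g \<in> borel_measurable M" and gu: "AE \<omega> in M. g \<omega> = sec_nrm \<X> u \<omega>"
      and gE: "fun_class M (\<lambda>\<omega>. complex_of_real (g \<omega>)) \<in> E"
      using E_sec_nrm[OF x] .
    have "fun_class M (\<lambda>\<omega>. complex_of_real (g \<omega>) + 1) \<in> E"
      using gE const_E[of 1] by (intro E_add) auto
    then show ?thesis
    proof (rule E_solid[OF a])
      show "AE \<omega> in M. cmod (a \<omega>) \<le> cmod (complex_of_real (g \<omega>) + 1)"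
        using gu AE_not_in[OF N] AE_space
      proof eventually_elim
        case (elim \<omega>)
        have "cmod (a \<omega>) \<le> g \<omega> + 1" using a_le[of \<omega>] elim by (simp add: G_def)
        also have "\<dots> \<le> cmod (complex_of_real (g \<omega> + 1))"
          unfolding norm_of_real by (rule abs_ge_self)
        finally show ?case by simp
      qed
    qed
  qed
  \<comment> \<open>Almost everywhere u + a e either vanishes or has the inverse z'. The second case
    is excluded by the choice of \<open>a\<close>, so the first holds.\<close>
  obtain B' z' where "Q a B' z'" using Q_ex[OF a aE] by blast
  then have "AE \<omega> in M. \<omega> \<in> B' \<longrightarrow> ?v \<omega> (a \<omega>) = \<zero>\<^bsub>\<X> \<omega>\<^esub>"
    "AE \<omega> in M. \<omega> \<notin> B' \<longrightarrow> fibre_inv_pair \<omega> (?v \<omega> (a \<omega>)) (the (z' \<omega>))"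
    unfolding Q_def by blast+
  \<comment> \<open>The sign changes because the resolvent was tested at u + a e; \<open>E\<close>
    contains -a by solidity.\<close>
  then have "AE \<omega> in M. the (u \<omega>) = (- a \<omega>) \<odot>\<^bsub>\<X> \<omega>\<^esub> the (e\<^sub>0 \<omega>)"
    using AE_not_in[OF N] AE_space
  proof eventually_elim
    case (elim \<omega>)
    then have \<omega>: "\<omega> \<in> space M - N" by blast
    interpret pointed_banach_algebra "\<X> \<omega>" "the (e\<^sub>0 \<omega>)" using good(1)[OF \<omega>] .
    have "\<not> inv_pair (?v \<omega> (a \<omega>)) (the (z' \<omega>))"
    proof (rule not_invertible_at_limit[OF good(2)[OF \<omega>] lim])
      fix k
      \<comment> \<open>Along the selected indices the resolvent bound is Suc
        (\<open>m k \<omega>\<close>), and k \<le> \<open>m k \<omega>\<close> turns it into the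
        bound k required in the limit lemma.\<close>
      have "real k \<le> real (Suc (m k \<omega>))" using mk[OF elim(4), of k] by simp
      then show "?v \<omega> (d (m k \<omega>) \<omega>) = \<zero>\<^bsub>\<X> \<omega>\<^esub> \<or>
          (\<exists>w. inv_pair (?v \<omega> (d (m k \<omega>) \<omega>)) w \<and> real k \<le> nrm (\<X> \<omega>) w)"
        using approx[OF \<omega>, of "m k \<omega>"] order_trans by blast
    qed (use \<omega> in blast)
    then have 0: "?v \<omega> (a \<omega>) = \<zero>\<^bsub>\<X> \<omega>\<^esub>" using elim(1,2) by blast
    have uc: "the (u \<omega>) \<in> carrier (\<X> \<omega>)" using good(2)[OF \<omega>] by simp
    show ?case
      using M.minus_equality[OF 0] uc by (simp add: sc_neg)
  qed
  moreover have "fun_class M (\<lambda>\<omega>. - a \<omega>) \<in> E"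
    using aE by (rule E_solid[rotated]) auto
  ultimately show ?thesis
    by (intro that[of "\<lambda>\<omega>. - a \<omega>"]) auto
qed

section \<open>The embedding of \<open>E\<close> as multiples of the unit, and its inverse\<close>

definition scalar_section :: "('a \<Rightarrow> complex) set \<Rightarrow> ('a \<rightharpoonup> 'b) set" where
  "scalar_section a = class_scale M \<X> L a e"

lemma scalar_section_fun_class:
  "f \<in> borel_measurable M \<Longrightarrow> scalar_section (fun_class M f) = sec_class M \<X> L (sec_scale \<X> f e\<^sub>0)"
  unfolding scalar_section_def by (rule class_scale_eq[OF _ E_secD[OF e_E_sec] e0])

lemma scale_e0_meas: "f \<in> borel_measurable M \<Longrightarrow> sec_scale \<X> f e\<^sub>0 \<in> meas_sections M \<X> L"
  by (rule meas_sections_scale[OF e0_meas])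

lemma scale_e0_nrm: "AE \<omega> in M. sec_nrm \<X> (sec_scale \<X> f e\<^sub>0) \<omega> = cmod (f \<omega>)"
  using AE_pointed meas_fibre[OF e0_meas]
proof eventually_elim
  case (elim \<omega>)
  then interpret pointed_banach_algebra "\<X> \<omega>" "the (e\<^sub>0 \<omega>)" by blast
  show ?case using elim(2) by (simp add: sec_nrm_def the_sec_scale nrm_smult)
qed

lemma scalar_section_E_sec:
  assumes "f \<in> borel_measurable M" "fun_class M f \<in> E"
  shows "scalar_section (fun_class M f) \<in> E_sec M E \<X> L"
  unfolding scalar_section_fun_class[OF assms(1)]
  by (rule E_secI[OF scale_e0_meas[OF assms(1)] assms(2)])
     (use scale_e0_nrm[of f] in \<open>eventually_elim, simp\<close>)

lemma scalar_section_rep: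
  assumes "f \<in> borel_measurable M"
  shows "scalar_section (fun_class M f) \<in> L0_sec M \<X> L"
    "sec_scale \<X> f e\<^sub>0 \<in> scalar_section (fun_class M f)"
  unfolding scalar_section_fun_class[OF assms]
  using sec_class_in_L0_sec sec_class_self scale_e0_meas[OF assms] by auto

lemma scalar_section_nrm:
  assumes "f \<in> borel_measurable M"
  shows "class_nrm M \<X> (scalar_section (fun_class M f)) = L0_abs M (fun_class M f)"
  unfolding class_nrm_eq[OF scalar_section_rep[OF assms]] L0_abs_fun_class[OF assms]
  using scale_e0_nrm[of f] by (intro fun_class_cong) (erule eventually_mono, simp)

lemma scalar_section_inj:
  assumes f: "f \<in> borel_measurable M" and g: "g \<in> borel_measurable M"
    and eq: "scalar_section (fun_class M f) = scalar_section (fun_class M g)"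
  shows "fun_class M f = fun_class M g"
proof (rule fun_class_cong)
  have "AE \<omega> in M. sec_scale \<X> f e\<^sub>0 \<omega> = sec_scale \<X> g e\<^sub>0 \<omega>"
    using scalar_section_rep[OF f] scalar_section_rep[OF g] unfolding eq
    by (intro L0_sec_AE_eq)
  then show "AE \<omega> in M. f \<omega> = g \<omega>"
    using AE_pointed meas_fibre[OF e0_meas]
  proof eventually_elim
    case (elim \<omega>)
    then interpret pointed_banach_algebra "\<X> \<omega>" "the (e\<^sub>0 \<omega>)" by blast
    have "f \<omega> \<odot>\<^bsub>\<X> \<omega>\<^esub> the (e\<^sub>0 \<omega>) = g \<omega> \<odot>\<^bsub>\<X> \<omega>\<^esub> the (e\<^sub>0 \<omega>)"
      using elim(1,3) by (simp add: sec_scale_def)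
    then have "(f \<omega> - g \<omega>) \<odot>\<^bsub>\<X> \<omega>\<^esub> the (e\<^sub>0 \<omega>) = \<zero>\<^bsub>\<X> \<omega>\<^esub>"
      using sc_l_distr[of "the (e\<^sub>0 \<omega>)" "f \<omega>" "- g \<omega>"] by (simp add: sc_neg M.r_neg)
    then have "cmod (f \<omega> - g \<omega>) = 0"
      using nrm_smult[of "the (e\<^sub>0 \<omega>)" "f \<omega> - g \<omega>"] by simp
    then show ?case by simp
  qed
qed

lemma scalar_section_add:
  assumes f[measurable]: "f \<in> borel_measurable M" and g[measurable]: "g \<in> borel_measurable M"
  shows "class_add M \<X> L (scalar_section (fun_class M f)) (scalar_section (fun_class M g))
    = scalar_section (L0_add M (fun_class M f) (fun_class M g))"
proof -
  have fg: "(\<lambda>\<omega>. f \<omega> + g \<omega>) \<in> borel_measurable M" by measurable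
  have "AE \<omega> in M. sec_add \<X> (sec_scale \<X> f e\<^sub>0) (sec_scale \<X> g e\<^sub>0) \<omega> = sec_scale \<X> (\<lambda>\<omega>. f \<omega> + g \<omega>) e\<^sub>0 \<omega>"
    using AE_pointed meas_fibre[OF e0_meas]
  proof eventually_elim
    case (elim \<omega>)
    then interpret pointed_banach_algebra "\<X> \<omega>" "the (e\<^sub>0 \<omega>)" by blast
    show ?case using elim(2) by (auto simp: sec_add_def sec_scale_def sc_l_distr dom_def)
  qed
  then show ?thesis
    unfolding class_add_eq[OF scalar_section_rep[OF f] scalar_section_rep[OF g]]
      L0_add_fun_class[OF f g] scalar_section_fun_class[OF fg]
    by (rule sec_class_cong)
qed

lemma scalar_section_mult:
  assumes f[measurable]: "f \<in> borel_measurable M" and g[measurable]: "g \<in> borel_measurable M"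
  shows "class_mult M \<X> L (scalar_section (fun_class M f)) (scalar_section (fun_class M g))
    = scalar_section (L0_mult M (fun_class M f) (fun_class M g))"
proof -
  have fg: "(\<lambda>\<omega>. f \<omega> * g \<omega>) \<in> borel_measurable M" by measurable
  have "AE \<omega> in M. sec_mult \<X> (sec_scale \<X> f e\<^sub>0) (sec_scale \<X> g e\<^sub>0) \<omega> = sec_scale \<X> (\<lambda>\<omega>. f \<omega> * g \<omega>) e\<^sub>0 \<omega>"
    using AE_pointed meas_fibre[OF e0_meas]
  proof eventually_elim
    case (elim \<omega>)
    then interpret pointed_banach_algebra "\<X> \<omega>" "the (e\<^sub>0 \<omega>)" by blast
    show ?case
      using elim(2) by (auto simp: sec_mult_def sec_scale_def smult_mult_l smult_mult_r mult.commute dom_def)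
  qed
  then show ?thesis
    unfolding class_mult_eq[OF scalar_section_rep[OF f] scalar_section_rep[OF g]]
      L0_mult_fun_class[OF f g] scalar_section_fun_class[OF fg]
    by (rule sec_class_cong)
qed

lemma scalar_section_scale:
  assumes f[measurable]: "f \<in> borel_measurable M" and g[measurable]: "g \<in> borel_measurable M"
  shows "class_scale M \<X> L (fun_class M f) (scalar_section (fun_class M g))
    = scalar_section (L0_mult M (fun_class M f) (fun_class M g))"
proof -
  have fg: "(\<lambda>\<omega>. f \<omega> * g \<omega>) \<in> borel_measurable M" by measurable
  have "AE \<omega> in M. sec_scale \<X> f (sec_scale \<X> g e\<^sub>0) \<omega> = sec_scale \<X> (\<lambda>\<omega>. f \<omega> * g \<omega>) e\<^sub>0 \<omega>"
    using AE_pointed meas_fibre[OF e0_meas]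
  proof eventually_elim
    case (elim \<omega>)
    then interpret pointed_banach_algebra "\<X> \<omega>" "the (e\<^sub>0 \<omega>)" by blast
    show ?case using elim(2) by (auto simp: sec_scale_def dom_def)
  qed
  then show ?thesis
    unfolding class_scale_eq[OF f scalar_section_rep[OF g]]
      L0_mult_fun_class[OF f g] scalar_section_fun_class[OF fg]
    by (rule sec_class_cong)
qed

lemma scalar_section_surj:
  assumes inv: "\<And>x. x \<in> E_sec M E \<X> L \<Longrightarrow> class_support M \<X> x = L0_one M \<Longrightarrow>
           \<exists>y\<in>E_sec M E \<X> L. class_mult M \<X> L x y = e \<and> class_mult M \<X> L y x = e"
    and x: "x \<in> E_sec M E \<X> L"
  shows "x \<in> scalar_section ` E"
proof -
  obtain u where u: "u \<in> x" using L0_sec_rep[OF E_secD[OF x]] .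
  show ?thesis
  proof (rule scalar_multiple_of_unit[OF inv x u])
    fix a assume a: "a \<in> borel_measurable M" "fun_class M a \<in> E"
      "AE \<omega> in M. the (u \<omega>) = a \<omega> \<odot>\<^bsub>\<X> \<omega>\<^esub> the (e\<^sub>0 \<omega>)"
    have "AE \<omega> in M. u \<omega> = sec_scale \<X> a e\<^sub>0 \<omega>"
      using a(3) meas_fibre[OF e0_meas] meas_fibre[OF L0_secD(1)[OF E_secD[OF x] u]]
      by eventually_elim (auto simp: sec_scale_def dom_def)
    then have "x = scalar_section (fun_class M a)"
      unfolding scalar_section_fun_class[OF a(1)] L0_secD(2)[OF E_secD[OF x] u]
      by (rule sec_class_cong)
    then show "x \<in> scalar_section ` E" using a(2) by blast
  qed
qed

lemma isometrically_isomorphic_if_inverses: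
  assumes inv: "\<And>x. x \<in> E_sec M E \<X> L \<Longrightarrow> class_support M \<X> x = L0_one M \<Longrightarrow>
           \<exists>y\<in>E_sec M E \<X> L. class_mult M \<X> L x y = e \<and> class_mult M \<X> L y x = e"
  shows "isometrically_isomorphic M E \<X> L"
proof -
  have bij: "bij_betw scalar_section E (E_sec M E \<X> L)"
    unfolding bij_betw_def
  proof
    show "inj_on scalar_section E"
    proof (rule inj_onI)
      fix a b assume ab: "a \<in> E" "b \<in> E" "scalar_section a = scalar_section b"
      obtain f where f: "f \<in> borel_measurable M" "a = fun_class M f" using E_rep[OF ab(1)] .
      obtain g where g: "g \<in> borel_measurable M" "b = fun_class M g" using E_rep[OF ab(2)] .
      show "a = b" using ab(3) unfolding f(2) g(2) by (rule scalar_section_inj[OF f(1) g(1)])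
    qed
    have "scalar_section a \<in> E_sec M E \<X> L" if a: "a \<in> E" for a
    proof -
      obtain f where f: "f \<in> borel_measurable M" "a = fun_class M f" using E_rep[OF a] .
      show ?thesis using a unfolding f(2) by (rule scalar_section_E_sec[OF f(1)])
    qed
    moreover have "x \<in> scalar_section ` E" if "x \<in> E_sec M E \<X> L" for x
      by (rule scalar_section_surj[OF inv that])
    ultimately show "scalar_section ` E = E_sec M E \<X> L" by blast
  qed
  \<comment> \<open>The algebraic laws are fibrewise identities for a |-> a e, where the coefficient
    is explicit. They are transferred to the inverse map through bijectivity.\<close>
  define \<phi> where "\<phi> = inv_into E scalar_section"
  have left: "\<phi> (scalar_section a) = a" if "a \<in> E" for a
    unfolding \<phi>_def by (rule bij_betw_inv_into_left[OF bij that])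
  have rep: "\<exists>f. f \<in> borel_measurable M \<and> fun_class M f \<in> E \<and> \<phi> x = fun_class M f
      \<and> x = scalar_section (fun_class M f)" if x: "x \<in> E_sec M E \<X> L" for x
  proof -
    have \<phi>x: "\<phi> x \<in> E"
      using bij_betw_apply[OF bij_betw_inv_into[OF bij] x] by (simp add: \<phi>_def)
    obtain f where "f \<in> borel_measurable M" "\<phi> x = fun_class M f" using E_rep[OF \<phi>x] .
    moreover have "scalar_section (\<phi> x) = x"
      unfolding \<phi>_def by (rule bij_betw_inv_into_right[OF bij x])
    ultimately show ?thesis using \<phi>x by auto
  qed
  show ?thesis
    unfolding isometrically_isomorphic_def
  proof (intro exI[of _ \<phi>] conjI ballI)
    show "bij_betw \<phi> (E_sec M E \<X> L) E"
      unfolding \<phi>_def by (rule bij_betw_inv_into[OF bij])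
  next
    fix x y assume "x \<in> E_sec M E \<X> L" "y \<in> E_sec M E \<X> L"
    then obtain f g where f: "f \<in> borel_measurable M" "fun_class M f \<in> E" "\<phi> x = fun_class M f"
        "x = scalar_section (fun_class M f)"
      and g: "g \<in> borel_measurable M" "fun_class M g \<in> E" "\<phi> y = fun_class M g"
        "y = scalar_section (fun_class M g)"
      using rep by metis
    have "class_add M \<X> L x y = scalar_section (L0_add M (\<phi> x) (\<phi> y))"
      unfolding f(3) g(3) unfolding f(4) g(4) by (rule scalar_section_add[OF f(1) g(1)])
    then show "\<phi> (class_add M \<X> L x y) = L0_add M (\<phi> x) (\<phi> y)"
      using left L0_add_in_E f(2,3) g(2,3) by metis
    have "class_mult M \<X> L x y = scalar_section (L0_mult M (\<phi> x) (\<phi> y))"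
      unfolding f(3) g(3) unfolding f(4) g(4) by (rule scalar_section_mult[OF f(1) g(1)])
    then show "\<phi> (class_mult M \<X> L x y) = L0_mult M (\<phi> x) (\<phi> y)"
      using left L0_mult_in_E f(2,3) g(2,3) by metis
  next
    fix a x assume a: "a \<in> E" and x: "x \<in> E_sec M E \<X> L"
    obtain f where f: "f \<in> borel_measurable M" "a = fun_class M f" using E_rep[OF a] .
    obtain g where g: "g \<in> borel_measurable M" "fun_class M g \<in> E" "\<phi> x = fun_class M g"
        "x = scalar_section (fun_class M g)"
      using rep[OF x] by metis
    have "class_scale M \<X> L a x = scalar_section (L0_mult M a (\<phi> x))"
      unfolding g(3) f(2) unfolding g(4) by (rule scalar_section_scale[OF f(1) g(1)])
    then show "\<phi> (class_scale M \<X> L a x) = L0_mult M a (\<phi> x)"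
      using left L0_mult_in_E a g(2,3) by metis
  next
    fix x assume "x \<in> E_sec M E \<X> L"
    then obtain f where f: "f \<in> borel_measurable M" "\<phi> x = fun_class M f"
        "x = scalar_section (fun_class M f)"
      using rep by metis
    show "L0_abs M (\<phi> x) = class_nrm M \<X> x"
      unfolding f(2) unfolding f(3) by (rule scalar_section_nrm[OF f(1), symmetric])
  qed
qed

end

text \<open>A simple section has at least one summand, so any one of the approximants exhibits a
  member of \<open>L\<close>. Applied to a representative of the unit, this makes the locale of
  bundles with nonempty \<open>L\<close> available.\<close>

lemma meas_sections_nonempty_imp:
  assumes "u \<in> meas_sections M \<X> L"
  shows "L \<noteq> {}"
  using assms by (auto simp: meas_sections_def simple_section_def)

theorem theorem3p1:
  fixes M :: "'a measure"
    and E :: "('a \<Rightarrow> complex) set set"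
    and \<X> :: "'a \<Rightarrow> 'b normed_alg"
    and L :: "('a \<rightharpoonup> 'b) set"
    and p :: "('a \<Rightarrow> complex) set \<Rightarrow> ('a \<Rightarrow> complex)"
    and ell :: "('a \<rightharpoonup> 'b) set \<Rightarrow> ('a \<rightharpoonup> 'b)"
    and e :: "('a \<rightharpoonup> 'b) set"
  assumes "finite_measure M"
    and "faithful_solid_subalgebra M E"
    and "measurable_bundle M \<X> L"
    and "lifting M p"
    and "vector_lifting M \<X> L p ell"
    and "normalized_unit M E \<X> L e"
    and "\<And>x. x \<in> E_sec M E \<X> L \<Longrightarrow> class_support M \<X> x = L0_one M \<Longrightarrow>
           \<exists>y\<in>E_sec M E \<X> L. class_mult M \<X> L x y = e \<and> class_mult M \<X> L y x = e"
  shows "isometrically_isomorphic M E \<X> L"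
proof -
  have "e \<in> L0_sec M \<X> L"
    using assms(6) by (simp add: normalized_unit_def E_sec_def)
  then have "L \<noteq> {}"
    using meas_sections_nonempty_imp by (force simp: L0_sec_def)
  then interpret unital_bundle M \<X> L E e
    using assms(2,3,6) by unfold_locales
  show ?thesis
    by (rule isometrically_isomorphic_if_inverses[OF assms(7)])
qed

end
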